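(* For all integers $r, k \geq 2$, we have $s_r(K_{k+1}) = P_r(k)$.
   Context: All graphs are finite and simple. For graphs $G,H$ and an integer $r\ge 1$, write $G \rightarrow (H)_r$ if every colouring of the edges of $G$ with $r$ colours contains a monochromatic copy of $H$. A graph $G$ is $r$-Ramsey-minimal for $H$ if $G \rightarrow (H)_r$ but no proper subgraph $G'\subsetneq G$ satisfies $G' \rightarrow (H)_r$. Define $s_r(H) := \min \delta(G)$ over all graphs $G$ that are $r$-Ramsey-minimal for $H$, where $\delta$ denotes minimum degree. A colour pattern on a vertex set $V$ is a sequence $G_1,\dots,G_r$ of pairwise edge-disjoint graphs all having vertex set $V$; it is $H$-free if no $G_i$ contains $H$ as a subgraph. Given a colour pattern $G_1,\dots,G_r$ on $V$ and a colouring $c: V \to [r]$ of the vertices, a strongly monochromatic $K_k$ is a set of $k$ vertices all receiving the same colour $i$ under $c$ and forming a clique in $G_i$. The $r$-colour $k$-clique packing number $P_r(k)$ is the smallest integer $n$ such that there exists a $K_{k+1}$-free colour pattern $G_1,\dots,G_r$ on an $n$-element vertex set $V$ such that every colouring $V \to [r]$ yields a strongly monochromatic $K_k$. *)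

theory Defs
  imports Main
begin

text \<open>Finite simple graphs with vertices drawn from nat (every finite graph is
isomorphic to one of these). A graph is a pair (V, E) of a finite vertex set
and a set of 2-element edges inside V.\<close>

definition graph :: "nat set \<Rightarrow> nat set set \<Rightarrow> bool" where
  "graph V E \<longleftrightarrow> finite V \<and> (\<forall>e\<in>E. \<exists>u v. u \<in> V \<and> v \<in> V \<and> u \<noteq> v \<and> e = {u, v})"

definition complete_graph :: "nat \<Rightarrow> nat set \<times> nat set set" where
  "complete_graph m = ({0..<m}, {{u, v} | u v. u < m \<and> v < m \<and> u \<noteq> v})"

definition contains_copy :: "nat set \<Rightarrow> nat set set \<Rightarrow> nat set \<times> nat set set \<Rightarrow> bool" where
  "contains_copy V E H \<longleftrightarrow>
     (\<exists>f. inj_on f (fst H) \<and> f ` fst H \<subseteq> V \<and> (\<forall>e\<in>snd H. f ` e \<in> E))"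

definition arrows :: "nat set \<Rightarrow> nat set set \<Rightarrow> nat set \<times> nat set set \<Rightarrow> nat \<Rightarrow> bool" where
  "arrows V E H r \<longleftrightarrow>
     (\<forall>c :: nat set \<Rightarrow> nat. (\<forall>e\<in>E. c e < r) \<longrightarrow>
        (\<exists>i<r. contains_copy V {e \<in> E. c e = i} H))"

definition ramsey_minimal :: "nat \<Rightarrow> nat set \<times> nat set set \<Rightarrow> nat set \<Rightarrow> nat set set \<Rightarrow> bool" where
  "ramsey_minimal r H V E \<longleftrightarrow> graph V E \<and> arrows V E H r \<and>
     (\<forall>V' E'. graph V' E' \<and> V' \<subseteq> V \<and> E' \<subseteq> E \<and> (V', E') \<noteq> (V, E) \<longrightarrow> \<not> arrows V' E' H r)"

definition degree :: "nat set set \<Rightarrow> nat \<Rightarrow> nat" where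
  "degree E v = card {e \<in> E. v \<in> e}"

definition min_degree :: "nat set \<Rightarrow> nat set set \<Rightarrow> nat" where
  "min_degree V E = Min (degree E ` V)"

definition s_ramsey :: "nat \<Rightarrow> nat set \<times> nat set set \<Rightarrow> nat" where
  "s_ramsey r H = Inf {min_degree V E | V E. ramsey_minimal r H V E}"

definition colour_pattern :: "nat set \<Rightarrow> nat \<Rightarrow> (nat \<Rightarrow> nat set set) \<Rightarrow> bool" where
  "colour_pattern V r Gs \<longleftrightarrow> (\<forall>i<r. graph V (Gs i)) \<and>
     (\<forall>i<r. \<forall>j<r. i \<noteq> j \<longrightarrow> Gs i \<inter> Gs j = {})"

definition pattern_free :: "nat set \<Rightarrow> nat \<Rightarrow> (nat \<Rightarrow> nat set set) \<Rightarrow> nat set \<times> nat set set \<Rightarrow> bool" where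
  "pattern_free V r Gs H \<longleftrightarrow> (\<forall>i<r. \<not> contains_copy V (Gs i) H)"

definition strongly_mono_clique :: "nat set \<Rightarrow> nat \<Rightarrow> (nat \<Rightarrow> nat set set) \<Rightarrow> (nat \<Rightarrow> nat) \<Rightarrow> nat \<Rightarrow> bool" where
  "strongly_mono_clique V r Gs c k \<longleftrightarrow>
     (\<exists>i<r. \<exists>S \<subseteq> V. card S = k \<and> (\<forall>v\<in>S. c v = i) \<and>
        (\<forall>u\<in>S. \<forall>v\<in>S. u \<noteq> v \<longrightarrow> {u, v} \<in> Gs i))"

definition clique_packing :: "nat \<Rightarrow> nat \<Rightarrow> nat" where
  "clique_packing r k = Inf {n. \<exists>V Gs. finite V \<and> card V = n \<and> colour_pattern V r Gs \<and>
      pattern_free V r Gs (complete_graph (k + 1)) \<and>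
      (\<forall>c :: nat \<Rightarrow> nat. (\<forall>v\<in>V. c v < r) \<longrightarrow> strongly_mono_clique V r Gs c k)}"

end

theory Submission
  imports Defs "HOL-Library.Ramsey" "HOL-Library.Nat_Bijection"
begin

text \<open>
  Deleting a vertex of minimum degree from a Ramsey-minimal graph leaves a graph with a
  \<open>K\<^sub>k\<^sub>+\<^sub>1\<close>-free colouring. Its restriction to the neighbourhood is a packing pattern,
  because a vertex colouring of the neighbourhood is the same as a colouring of the deleted edges.

  Conversely, from a packing pattern on \<open>n\<close> vertices we build a non-Ramsey graph in which every
  \<open>K\<^sub>k\<^sub>+\<^sub>1\<close>-free colouring contains a homomorphic image of the pattern, up to a permutation of the
  colours. Adding a vertex joined to \<open>X\<close>, for each set \<open>X\<close> of at most \<open>n\<close> vertices, makes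
  this graph Ramsey, and each of its minimal Ramsey subgraphs contains an added vertex, of degree at
  most \<open>n\<close>.

  In place of signal senders, the graph comes from the partite construction of Nesetril and Rodl:
  there is a \<open>K\<^sub>k\<^sub>+\<^sub>1\<close>-free edge-coloured graph such that every recolouring contains a copy of each
  small \<open>K\<^sub>k\<^sub>+\<^sub>1\<close>-free coloured graph on which the new colour is a function \<open>\<sigma>\<close> of the old one.
  Applied to \<open>K\<^sub>k\<^sub>+\<^sub>1\<close> with one edge of colour \<open>i\<close> and the others of colour \<open>j\<close>, this forces
  \<open>\<sigma> i \<noteq> \<sigma> j\<close>, so \<open>\<sigma>\<close> is a permutation.
\<close>

section \<open>The Hales--Jewett theorem\<close>

definition fill :: "'a \<Rightarrow> 'a option list \<Rightarrow> 'a list" where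
  "fill e t = map (case_option e id) t"

text \<open>A combinatorial line is a list with \<open>None\<close> at its moving coordinates.\<close>

definition templates :: "'a set \<Rightarrow> nat \<Rightarrow> 'a option list set" where
  "templates E n = {t. length t = n \<and> None \<in> set t \<and> set t \<subseteq> insert None (Some ` E)}"

definition words :: "'a set \<Rightarrow> nat \<Rightarrow> 'a list set" where
  "words E n = {w. set w \<subseteq> E \<and> length w = n}"

lemma finite_words: "finite E \<Longrightarrow> finite (words E n)"
  unfolding words_def by (rule finite_lists_length_eq)

lemma finite_templates: "finite E \<Longrightarrow> finite (templates E n)"
  by (rule finite_subset[OF _ finite_words[of "insert None (Some ` E)" n]])
    (auto simp: templates_def words_def)

lemma fill_append: "fill e (t @ u) = fill e t @ fill e u"
  by (simp add: fill_def)

lemma fill_map_Some [simp]: "fill e (map Some w) = w"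
  by (simp add: fill_def comp_def)

lemma fill_in_words: "t \<in> templates E n \<Longrightarrow> E \<subseteq> E' \<Longrightarrow> e \<in> E' \<Longrightarrow> fill e t \<in> words E' n"
  by (fastforce simp: templates_def words_def fill_def split: option.splits)

lemma words_append: "v \<in> words E m \<Longrightarrow> w \<in> words E n \<Longrightarrow> v @ w \<in> words E (m + n)"
  by (auto simp: words_def)

lemma templates_append:
  assumes "t \<in> templates E m" "u \<in> templates E n"
  shows "t @ u \<in> templates E (m + n)"
  using assms by (auto simp: templates_def)

lemma templates_append_word:
  assumes "t \<in> templates E m" "w \<in> words E n"
  shows "t @ map Some w \<in> templates E (m + n)" "map Some w @ t \<in> templates E (n + m)"
  using assms by (auto simp: templates_def words_def)

lemma templates_mono: "E \<subseteq> E' \<Longrightarrow> templates E n \<subseteq> templates E' n"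
  by (auto simp: templates_def)

lemma words_mono: "E \<subseteq> E' \<Longrightarrow> words E n \<subseteq> words E' n"
  by (auto simp: words_def)

text \<open>Induction on the alphabet by colour focusing. For a letter \<open>a\<close> added to
  \<open>E\<close>, lines that are monochromatic on \<open>E\<close> are collected in more and more
  colours, all passing through one point at \<open>a\<close>; once the palette is exceeded, one of
  them must have been monochromatic at \<open>a\<close> too.\<close>

theorem hales_jewett:
  assumes "finite E"
  shows "\<exists>n. \<forall>c. c ` words E n \<subseteq> {..<r :: nat} \<longrightarrow>
    (\<exists>t \<in> templates E n. \<exists>col. \<forall>e\<in>E. c (fill e t) = col)"
  using assms
proof (induction E arbitrary: r rule: finite_induct)
  case empty
  have "[None] \<in> templates {} 1"
    by (simp add: templates_def)
  then show ?case by blast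
next
  case (insert a E)
  let ?A = "insert a E"
  let ?mono = "\<lambda>n c. \<exists>t \<in> templates ?A n. \<exists>col. \<forall>e\<in>?A. c (fill e t) = col"
  show ?case
  proof (cases "E = {}")
    case True
    have "[None] \<in> templates ?A 1"
      by (simp add: templates_def)
    then show ?thesis using True by blast
  next
    case False
    \<comment> \<open>The letter \<open>e0\<close> is where the colour of a line that is
      monochromatic on \<open>E\<close> is read off.\<close>
    then obtain e0 where e0: "e0 \<in> E" by blast
    text \<open>Colour focusing: \<open>s\<close> lines with a common point at \<open>a\<close>, each monochromatic on \<open>E\<close>, in
      \<open>s\<close> different colours.\<close>
    have focus: "\<exists>n. \<forall>c. c ` words ?A n \<subseteq> {..<r} \<longrightarrow> ?mono n c \<or>
        (\<exists>f \<in> words ?A n. \<exists>C. finite C \<and> card C = s \<and>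
          (\<forall>col\<in>C. \<exists>t \<in> templates ?A n. fill a t = f \<and> (\<forall>e\<in>E. c (fill e t) = col)))" for s
    proof (induction s)
      case 0
      have "[] \<in> words ?A 0" by (simp add: words_def)
      then show ?case by (intro exI[of _ 0]) force
    next
      case (Suc s)
      then obtain n where n: "\<And>c. c ` words ?A n \<subseteq> {..<r} \<Longrightarrow> ?mono n c \<or>
        (\<exists>f \<in> words ?A n. \<exists>C. finite C \<and> card C = s \<and>
          (\<forall>col\<in>C. \<exists>t \<in> templates ?A n. fill a t = f \<and> (\<forall>e\<in>E. c (fill e t) = col)))"
        by blast
      have "finite (words ?A n)" using insert by (intro finite_words) auto
      then have finK: "finite (words ?A n \<rightarrow>\<^sub>E {..<r})" (is "finite ?K")
        by (intro finite_PiE) auto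
      \<comment> \<open>A colouring of the whole cube of dimension \<open>n\<close> is treated as a
        single colour, numbered by \<open>g\<close>. This is why the induction on the alphabet keeps
        the number of colours arbitrary.\<close>
      then obtain g :: "('a list \<Rightarrow> nat) \<Rightarrow> nat" and R where g: "inj_on g ?K" "g ` ?K = {..<R}"
        using finite_imp_inj_to_nat_seg[OF finK] by (auto simp: lessThan_def)
      obtain m where m: "\<And>c. c ` words E m \<subseteq> {..<R} \<Longrightarrow>
          \<exists>t \<in> templates E m. \<exists>col. \<forall>e\<in>E. c (fill e t) = col"
        using insert.IH[of R] by blast
      have "?mono (m + n) c \<or> (\<exists>f \<in> words ?A (m + n). \<exists>C. finite C \<and> card C = Suc s \<and>
          (\<forall>col\<in>C. \<exists>t \<in> templates ?A (m + n). fill a t = f \<and> (\<forall>e\<in>E. c (fill e t) = col)))"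
        if c: "c ` words ?A (m + n) \<subseteq> {..<r}" for c
      proof -
        define d where "d v = restrict (\<lambda>w. c (v @ w)) (words ?A n)" for v
        have dK: "d v \<in> ?K" if "v \<in> words ?A m" for v
          using c words_append[OF that] by (auto simp: d_def)
        have "(\<lambda>v. g (d v)) ` words E m \<subseteq> {..<R}"
          using dK g(2) words_mono[of E ?A m] by blast
        from m[OF this] obtain t col where t: "t \<in> templates E m"
          and "\<forall>e\<in>E. g (d (fill e t)) = col" by blast
        then have deq: "d (fill e t) = d (fill e0 t)" if "e \<in> E" for e
          using that e0 dK fill_in_words[OF t, of ?A] inj_onD[OF g(1)]
          by (metis insertCI subset_insertI)
        have tA: "t \<in> templates ?A m" using t templates_mono[of E ?A] by blast
        \<comment> \<open>All prefixes on the line \<open>t\<close> with letter in \<open>E\<close>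
          induce this one colouring of the last \<open>n\<close> coordinates; the focusing
          hypothesis is applied to it.\<close>
        define c' where "c' w = c (fill e0 t @ w)" for w
        have ceq: "c (fill e t @ w) = c' w" if "e \<in> E" "w \<in> words ?A n" for e w
          using deq[OF that(1)] that(2) unfolding d_def c'_def by (metis restrict_apply')
        have f0: "fill e0 t \<in> words ?A m" using fill_in_words[OF t, of ?A e0] e0 by blast
        have "c' ` words ?A n \<subseteq> {..<r}"
          using c words_append[OF f0] by (auto simp: c'_def)
        from n[OF this] show ?thesis
        proof (elim disjE bexE exE conjE)
          fix u col assume u: "u \<in> templates ?A n" "\<forall>e\<in>?A. c' (fill e u) = col"
          then show ?thesis
            using templates_append_word(2)[OF u(1) f0]
            by (intro disjI1 bexI[of _ "map Some (fill e0 t) @ u"]) (auto simp: fill_append c'_def)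
        next
          fix f C assume f: "f \<in> words ?A n" and C: "finite C" "card C = s"
            and foc: "\<forall>col\<in>C. \<exists>t\<in>templates ?A n. fill a t = f \<and> (\<forall>e\<in>E. c' (fill e t) = col)"
          show ?thesis
          proof (cases "c' f \<in> C")
            \<comment> \<open>The focus already has the colour of one of its lines, so that line is
              monochromatic at \<open>a\<close> as well.\<close>
            case True
            with foc obtain u where u: "u \<in> templates ?A n" "fill a u = f"
              "\<forall>e\<in>E. c' (fill e u) = c' f" by blast
            then show ?thesis
              using templates_append_word(2)[OF u(1) f0]
              by (intro disjI1 bexI[of _ "map Some (fill e0 t) @ u"]) (auto simp: fill_append c'_def)
          next
            case False
            \<comment> \<open>The focus becomes \<open>fill a t @ f\<close>. Each old colour keeps
              its line, now moving along \<open>t\<close> at the same time; the line moving along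
              \<open>t\<close> alone, with \<open>f\<close> fixed, has the new colour
              \<open>c' f\<close>.\<close>
            have fa: "fill a t @ f \<in> words ?A (m + n)"
              using fill_in_words[OF tA, of ?A a] f by (auto intro: words_append)
            have "\<exists>t' \<in> templates ?A (m + n). fill a t' = fill a t @ f \<and> (\<forall>e\<in>E. c (fill e t') = col)"
              if "col \<in> insert (c' f) C" for col
            proof (cases "col \<in> C")
              case True
              with foc obtain u where u: "u \<in> templates ?A n" "fill a u = f"
                "\<forall>e\<in>E. c' (fill e u) = col" by blast
              have "fill e u \<in> words ?A n" if "e \<in> E" for e
                using fill_in_words[OF u(1), of ?A e] that by blast
              then show ?thesis using u templates_append[OF tA u(1)]
                by (intro bexI[of _ "t @ u"]) (auto simp: fill_append ceq)
            next
              case False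
              then have "col = c' f" using that by simp
              then show ?thesis using f templates_append_word(1)[OF tA f]
                by (intro bexI[of _ "t @ map Some f"]) (auto simp: fill_append ceq)
            qed
            then show ?thesis using fa C False
              by (intro disjI2 bexI[of _ "fill a t @ f"] exI[of _ "insert (c' f) C"]) auto
          qed
        qed
      qed
      then show ?case by blast
    qed
    \<comment> \<open>\<open>Suc r\<close> different colours cannot all be values of
      \<open>c\<close>, so only the monochromatic line remains.\<close>
    obtain n where n: "\<And>c. c ` words ?A n \<subseteq> {..<r} \<Longrightarrow> ?mono n c \<or>
        (\<exists>f \<in> words ?A n. \<exists>C. finite C \<and> card C = Suc r \<and>
          (\<forall>col\<in>C. \<exists>t \<in> templates ?A n. fill a t = f \<and> (\<forall>e\<in>E. c (fill e t) = col)))"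
      using focus[of "Suc r"] by blast
    have "?mono n c" if c: "c ` words ?A n \<subseteq> {..<r}" for c
    proof (rule ccontr)
      assume "\<not> ?mono n c"
      with n[OF c] obtain C where C: "finite C" "card C = Suc r"
        and foc: "\<forall>col\<in>C. \<exists>t \<in> templates ?A n. \<forall>e\<in>E. c (fill e t) = col"
        by meson
      have "C \<subseteq> {..<r}"
      proof
        fix col assume "col \<in> C"
        with foc obtain t where t: "t \<in> templates ?A n" "c (fill e0 t) = col" using e0 by blast
        then show "col \<in> {..<r}" using c fill_in_words[OF t(1), of ?A e0] e0 by blast
      qed
      then show False using C card_mono[of "{..<r}" C] by simp
    qed
    then show ?thesis by blast
  qed
qed

section \<open>The partite construction\<close>

text \<open>An edge-coloured graph is a set of triples (tail, head, colour), with every edge oriented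
  towards the larger value of \<open>part\<close>.\<close>

definition picture :: "('v \<Rightarrow> nat) \<Rightarrow> nat \<Rightarrow> nat \<Rightarrow> ('v \<times> 'v \<times> nat) set \<Rightarrow> bool" where
  "picture part r k F \<longleftrightarrow> finite F \<and>
     (\<forall>x y i. (x, y, i) \<in> F \<longrightarrow> part x < part y \<and> i < r) \<and>
     (\<forall>x y i j. (x, y, i) \<in> F \<longrightarrow> (x, y, j) \<in> F \<longrightarrow> i = j) \<and>
     (\<forall>i S. card S = k + 1 \<longrightarrow> \<not> (\<forall>x\<in>S. \<forall>y\<in>S. x \<noteq> y \<longrightarrow> (x, y, i) \<in> F \<or> (y, x, i) \<in> F))"

lemma pictureD:
  assumes "picture part r k F"
  shows "finite F"
    and "(x, y, i) \<in> F \<Longrightarrow> part x < part y"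
    and "(x, y, i) \<in> F \<Longrightarrow> i < r"
    and "(x, y, i) \<in> F \<Longrightarrow> (x, y, j) \<in> F \<Longrightarrow> i = j"
    and "card S = k + 1 \<Longrightarrow> (\<And>x y. x \<in> S \<Longrightarrow> y \<in> S \<Longrightarrow> x \<noteq> y \<Longrightarrow> (x, y, i) \<in> F \<or> (y, x, i) \<in> F) \<Longrightarrow> False"
  using assms unfolding picture_def by blast+

text \<open>One type closed under all steps of the construction: in the first picture a vertex is tagged
  with its copy; a step on the parts \<open>p\<close>, \<open>q\<close> turns their vertices into words and makes one
  copy per combinatorial line of every other vertex.\<close>

datatype vtx =
    Base nat "nat set" "(nat \<times> nat \<times> nat) set"
  | Word nat "vtx list"
  | Copy "(vtx \<times> vtx) option list" vtx

primrec part :: "vtx \<Rightarrow> nat" where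
  "part (Base p S A) = p"
| "part (Word p w) = p"
| "part (Copy t x) = part x"

text \<open>Embedding of the copy indexed by the line \<open>t\<close>. In parts \<open>p\<close>
  and \<open>q\<close> the moving coordinates receive the vertex itself and the fixed ones the tail
  or the head of the edge prescribed by \<open>t\<close>. Copies of different lines can therefore
  meet only in these two parts.\<close>

definition line_copy :: "nat \<Rightarrow> nat \<Rightarrow> (vtx \<times> vtx) option list \<Rightarrow> vtx \<Rightarrow> vtx" where
  "line_copy p q t x =
     (if part x = p then Word p (map (case_option x fst) t)
      else if part x = q then Word q (map (case_option x snd) t)
      else Copy t x)"

lemma part_line_copy [simp]: "part (line_copy p q t x) = part x"
  by (simp add: line_copy_def)

text \<open>A moving coordinate of \<open>t\<close> shows the inserted vertex itself.\<close>

lemma inj_line_copy: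
  assumes N: "None \<in> set t" and eq: "line_copy p q t x = line_copy p q t y"
  shows "x = y"
proof -
  have "part x = part y"
    using arg_cong[OF eq, of part] by simp
  moreover have "x = y" if "map (case_option x f) t = map (case_option y f) t" for f :: "vtx \<times> vtx \<Rightarrow> vtx"
    using that N unfolding map_eq_conv by force
  ultimately show ?thesis
    using eq by (simp add: line_copy_def split: if_splits)
qed

text \<open>Hales-Jewett over the alphabet of all edges of colour \<open>i\<close> from part
  \<open>p\<close> to part \<open>q\<close>: every line carries a copy of \<open>F\<close>, and on a
  monochromatic line all these edges get the same new colour. No large clique arises, because it
  would have a vertex outside the two parts and so lie in a single induced copy.\<close>

lemma partite_lemma:
  assumes pic: "picture part r k F" and k: "k \<ge> 2" and pq: "p < q"
  obtains F' where "picture part r k F'"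
    and "\<And>\<chi>. (\<And>x y. \<chi> x y < r) \<Longrightarrow>
      \<exists>h col. (\<forall>x. part (h x) = part x) \<and> (\<forall>x y j. (x, y, j) \<in> F \<longrightarrow> (h x, h y, j) \<in> F') \<and>
        (\<forall>x y. (x, y, i) \<in> F \<longrightarrow> part x = p \<longrightarrow> part y = q \<longrightarrow> \<chi> (h x) (h y) = col)"
proof -
  define E where "E = {(x, y). (x, y, i) \<in> F \<and> part x = p \<and> part y = q}"
  have "E \<subseteq> (\<lambda>(x, y, j). (x, y)) ` F" by (force simp: E_def)
  then have finE: "finite E" using pictureD(1)[OF pic] finite_surj by blast
  obtain n where n: "\<And>c. c ` words E n \<subseteq> {..<r} \<Longrightarrow>
      \<exists>t \<in> templates E n. \<exists>col. \<forall>e\<in>E. c (fill e t) = col"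
    using hales_jewett[OF finE, of r] by blast
  define T where "T = templates E n"
  let ?h = "line_copy p q"
  define F' where "F' = (\<Union>t\<in>T. (\<lambda>(x, y, j). (?h t x, ?h t y, j)) ` F)"
  have F'I: "(?h t x, ?h t y, j) \<in> F'" if "t \<in> T" "(x, y, j) \<in> F" for t x y j
    using that unfolding F'_def by force
  have F'E: "\<exists>t\<in>T. \<exists>x y. X = ?h t x \<and> Y = ?h t y \<and> (x, y, j) \<in> F" if "(X, Y, j) \<in> F'" for X Y j
    using that unfolding F'_def by force
  have TN: "None \<in> set t" if "t \<in> T" for t using that by (simp add: T_def templates_def)
  \<comment> \<open>At each coordinate the two words of a line show either the inserted pair
    \<open>(y, z)\<close> or the ends of a fixed edge of colour \<open>i\<close>.\<close>
  have entry: "(y, z) = ((case_option y fst (t ! m)), (case_option z snd (t ! m))) \<and> t ! m = None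
      \<or> (case_option y fst (t ! m), case_option z snd (t ! m), i) \<in> F"
    if "t \<in> T" "m < n" for t m and y z :: vtx
  proof (cases "t ! m")
    case (Some e)
    then have "Some e \<in> set t" using that by (auto simp: T_def templates_def in_set_conv_nth)
    then have "e \<in> E" using that by (auto simp: T_def templates_def)
    then show ?thesis using Some by (auto simp: E_def)
  qed simp
  text \<open>Copies are induced in every colour \<open>j\<close>: two lines through the same pair of words agree at
    a moving coordinate of either line, or that coordinate is an edge of colour \<open>i\<close>.\<close>
  have induced: "(y, z, j) \<in> F"
    if tt: "t \<in> T" "t' \<in> T" and eq: "?h t y = ?h t' y'" "?h t z = ?h t' z'"
      and F: "(y', z', j) \<in> F" for t t' y z y' z' j
  proof -
    have pe: "part y' = part y" "part z' = part z" using eq by (metis part_line_copy)+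
    have lt: "part y < part z" using pictureD(2)[OF pic F] pe by simp
    show ?thesis
    proof (cases "part y = p \<and> part z = q")
      case True
      have ly: "length t = n" "length t' = n" using tt by (auto simp: T_def templates_def)
      have my: "case_option y fst (t ! m) = case_option y' fst (t' ! m)"
        and mz: "case_option z snd (t ! m) = case_option z' snd (t' ! m)" if "m < n" for m
      proof -
        have "map (case_option y fst) t = map (case_option y' fst) t'"
          "map (case_option z snd) t = map (case_option z' snd) t'"
          using eq True pe pq by (auto simp: line_copy_def)
        then show "case_option y fst (t ! m) = case_option y' fst (t' ! m)"
          "case_option z snd (t ! m) = case_option z' snd (t' ! m)"
          using that ly by (metis nth_map)+
      qed
      obtain m where m: "m < n" "t' ! m = None"
        using TN[OF tt(2)] ly by (auto simp: in_set_conv_nth)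
      obtain m' where m': "m' < n" "t ! m' = None"
        using TN[OF tt(1)] ly by (auto simp: in_set_conv_nth)
      show ?thesis
      proof (cases "t ! m = None")
        case True
        then show ?thesis using my[OF m(1)] mz[OF m(1)] m F by simp
      next
        \<comment> \<open>At \<open>m\<close> the line \<open>t\<close> shows a fixed edge of colour
          \<open>i\<close> and \<open>t'\<close> shows \<open>(y', z')\<close>, so
          \<open>j = i\<close>. A moving coordinate \<open>m'\<close> of \<open>t\<close> then gives
          the claim.\<close>
        case False
        then have "(y', z', i) \<in> F" using entry[OF tt(1) m(1), of y z] my[OF m(1)] mz[OF m(1)] m by auto
        then have "j = i" using pictureD(4)[OF pic F] by blast
        moreover have "y = y' \<and> z = z' \<or> (y, z, i) \<in> F"
          using entry[OF tt(2) m'(1), of y' z'] my[OF m'(1)] mz[OF m'(1)] m' by auto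
        ultimately show ?thesis using F by auto
      qed
    next
      case False
      \<comment> \<open>One end lies outside both parts, where \<open>Copy\<close> records the
        line.\<close>
      then have "part y \<notin> {p, q} \<or> part z \<notin> {p, q}" using lt pq by auto
      then have "t = t'" using eq pe by (auto simp: line_copy_def split: if_splits)
      then have "y = y'" "z = z'" using inj_line_copy[OF TN[OF tt(1)]] eq by blast+
      then show ?thesis using F by simp
    qed
  qed
  have lt': "part x < part y" if "(x, y, j) \<in> F'" for x y j
    using F'E[OF that] pictureD(2)[OF pic] by fastforce
  have "picture part r k F'"
    unfolding picture_def
  proof (intro conjI allI impI notI)
    show "finite F'"
      unfolding F'_def T_def using finite_templates[OF finE] pictureD(1)[OF pic] by blast
  next
    fix x y j assume "(x, y, j) \<in> F'"
    from F'E[OF this] obtain t x' y' where "x = ?h t x'" "y = ?h t y'" "(x', y', j) \<in> F" by blast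
    then show "part x < part y" "j < r" using pictureD(2,3)[OF pic] by auto
  next
    fix X Y j j' assume XY: "(X, Y, j) \<in> F'" "(X, Y, j') \<in> F'"
    obtain t x y where t: "t \<in> T" "X = ?h t x" "Y = ?h t y" "(x, y, j) \<in> F"
      using F'E[OF XY(1)] by blast
    obtain t' x' y' where t': "t' \<in> T" "X = ?h t' x'" "Y = ?h t' y'" "(x', y', j') \<in> F"
      using F'E[OF XY(2)] by blast
    have "(x, y, j') \<in> F" by (rule induced[OF t(1) t'(1) _ _ t'(4)]) (use t t' in simp_all)
    then show "j = j'" using pictureD(4)[OF pic t(4)] by blast
  next
    fix j S
    assume S: "card S = k + 1"
      and cl: "\<forall>x\<in>S. \<forall>y\<in>S. x \<noteq> y \<longrightarrow> (x, y, j) \<in> F' \<or> (y, x, j) \<in> F'"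
    have finS: "finite S" using S card.infinite by fastforce
    \<comment> \<open>Adjacent vertices lie in different parts, so the clique meets
      \<open>k + 1\<close> parts, at least three, and has a vertex outside \<open>p\<close> and
      \<open>q\<close>.\<close>
    have "inj_on part S"
    proof (rule inj_onI, rule ccontr)
      fix x y assume "x \<in> S" "y \<in> S" "part x = part y" "x \<noteq> y"
      with cl have "(x, y, j) \<in> F' \<or> (y, x, j) \<in> F'" by blast
      with lt' have "part x \<noteq> part y" by fastforce
      with \<open>part x = part y\<close> show False by blast
    qed
    then have "card (part ` S) = k + 1" using S card_image by fastforce
    moreover have "card (part ` S) \<le> 2" if "part ` S \<subseteq> {p, q}"
      using card_mono[OF _ that] pq by simp
    ultimately obtain X where X: "X \<in> S" "part X \<notin> {p, q}" using k by fastforce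
    have "card (S - {X}) = k" using S X(1) finS by simp
    then have "S - {X} \<noteq> {}" using k by (metis card.empty not_numeral_le_zero)
    then obtain Y where "Y \<in> S" "Y \<noteq> X" by blast
    then have "(X, Y, j) \<in> F' \<or> (Y, X, j) \<in> F'" using cl X by blast
    then obtain t x where tx: "t \<in> T" "X = ?h t x" using F'E by blast
    \<comment> \<open>\<open>X\<close> is tagged with \<open>t\<close>, so every edge at
      \<open>X\<close> comes from the copy \<open>t\<close>, and with it the whole clique.\<close>
    have "\<exists>y. Y = ?h t y" if "Y \<in> S" for Y
    proof (cases "Y = X")
      case False
      then obtain t' x' y where t': "t' \<in> T" "X = ?h t' x'" "Y = ?h t' y"
      proof -
        have "(X, Y, j) \<in> F' \<or> (Y, X, j) \<in> F'" using cl X \<open>Y \<in> S\<close> False by blast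
        then show ?thesis using F'E that by blast
      qed
      then have "t' = t" using X tx by (auto simp: line_copy_def split: if_splits)
      then show ?thesis using t' by blast
    qed (use tx in blast)
    then have "S \<subseteq> range (?h t)" by blast
    then obtain S0 where S0: "S = ?h t ` S0" by (auto elim: subset_imageE)
    have inj: "inj (?h t)" using inj_line_copy[OF TN[OF tx(1)]] by (auto intro: injI)
    have "card S0 = k + 1" using S S0 card_image[OF inj_on_subset[OF inj subset_UNIV]] by simp
    then show False
    proof (rule pictureD(5)[OF pic])
      fix y z assume "y \<in> S0" "z \<in> S0" "y \<noteq> z"
      then have "(?h t y, ?h t z, j) \<in> F' \<or> (?h t z, ?h t y, j) \<in> F'"
        using cl S0 injD[OF inj] by blast
      moreover have "(y, z, j) \<in> F" if "(?h t y, ?h t z, j) \<in> F'" for y z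
        using F'E[OF that] induced[OF tx(1)] by blast
      ultimately show "(y, z, j) \<in> F \<or> (z, y, j) \<in> F" by blast
    qed
  qed
  moreover have "\<exists>h col. (\<forall>x. part (h x) = part x) \<and> (\<forall>x y j. (x, y, j) \<in> F \<longrightarrow> (h x, h y, j) \<in> F') \<and>
        (\<forall>x y. (x, y, i) \<in> F \<longrightarrow> part x = p \<longrightarrow> part y = q \<longrightarrow> \<chi> (h x) (h y) = col)"
    if "\<And>x y. \<chi> x y < r" for \<chi>
  proof -
    \<comment> \<open>A word over \<open>E\<close> splits into the word of its tails and the word of
      its heads, which are vertices of parts \<open>p\<close> and \<open>q\<close>; it is coloured
      by \<open>\<chi>\<close> of this pair.\<close>
    obtain t col where t: "t \<in> templates E n"
      "\<forall>e\<in>E. \<chi> (Word p (map fst (fill e t))) (Word q (map snd (fill e t))) = col"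
      using n[of "\<lambda>w. \<chi> (Word p (map fst w)) (Word q (map snd w))"] \<open>\<And>x y. \<chi> x y < r\<close> by blast
    have "\<chi> (?h t x) (?h t y) = col" if "(x, y, i) \<in> F" "part x = p" "part y = q" for x y
    proof -
      have "map fst (fill (x, y) t) = map (case_option x fst) t"
        "map snd (fill (x, y) t) = map (case_option y snd) t"
        by (auto simp: fill_def split: option.splits)
      moreover have "(x, y) \<in> E" using that by (simp add: E_def)
      ultimately have "\<chi> (Word p (map (case_option x fst) t)) (Word q (map (case_option y snd) t)) = col"
        using bspec[OF t(2), of "(x, y)"] by simp
      then show ?thesis using that pq by (auto simp: line_copy_def)
    qed
    then show ?thesis using F'I t(1) by (intro exI[of _ "?h t"] exI[of _ col]) (auto simp: T_def)
  qed
  ultimately show ?thesis using that by blast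
qed

text \<open>One triple is homogenised at a time. Later maps preserve parts and old colours, so
  composing with them keeps what was achieved before.\<close>

lemma partite_iteration:
  assumes "picture part r k F" "k \<ge> 2" "\<forall>(p, q, i) \<in> set ts. p < q"
  shows "\<exists>F'. picture part r k F' \<and> (\<forall>\<chi>. (\<forall>x y. \<chi> x y < r) \<longrightarrow>
      (\<exists>h col. (\<forall>x. part (h x) = part x) \<and> (\<forall>x y j. (x, y, j) \<in> F \<longrightarrow> (h x, h y, j) \<in> F') \<and>
        (\<forall>x y i. (x, y, i) \<in> F \<longrightarrow> (part x, part y, i) \<in> set ts \<longrightarrow>
           \<chi> (h x) (h y) = col (part x, part y, i))))"
  using assms
proof (induction ts arbitrary: F)
  case Nil
  then show ?case by (intro exI[of _ F] conjI allI impI exI[of _ id]) auto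
next
  case (Cons a ts)
  obtain p q i where a: "a = (p, q, i)" by (cases a)
  then have pq: "p < q" using Cons.prems(3) by simp
  obtain F1 where F1: "picture part r k F1"
    and h1: "\<And>\<chi>. (\<And>x y. \<chi> x y < r) \<Longrightarrow>
      \<exists>h col. (\<forall>x. part (h x) = part x) \<and> (\<forall>x y j. (x, y, j) \<in> F \<longrightarrow> (h x, h y, j) \<in> F1) \<and>
        (\<forall>x y. (x, y, i) \<in> F \<longrightarrow> part x = p \<longrightarrow> part y = q \<longrightarrow> \<chi> (h x) (h y) = col)"
    by (rule partite_lemma[OF Cons.prems(1,2) pq, where i = i]) (blast intro: that)
  have "\<forall>(p, q, i) \<in> set ts. p < q"
    using Cons.prems(3) by simp
  from Cons.IH[OF F1 Cons.prems(2) this]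
  obtain F' where F': "picture part r k F'"
    and h2: "\<And>\<chi>. \<forall>x y. \<chi> x y < r \<Longrightarrow>
      (\<exists>h col. (\<forall>x. part (h x) = part x) \<and> (\<forall>x y j. (x, y, j) \<in> F1 \<longrightarrow> (h x, h y, j) \<in> F') \<and>
        (\<forall>x y i. (x, y, i) \<in> F1 \<longrightarrow> (part x, part y, i) \<in> set ts \<longrightarrow>
           \<chi> (h x) (h y) = col (part x, part y, i)))"
    by blast
  show ?case
  proof (intro exI[of _ F'] conjI F' allI impI)
    fix \<chi> :: "vtx \<Rightarrow> vtx \<Rightarrow> nat" assume \<chi>: "\<forall>x y. \<chi> x y < r"
    obtain h col where h: "\<forall>x. part (h x) = part x" "\<forall>x y j. (x, y, j) \<in> F1 \<longrightarrow> (h x, h y, j) \<in> F'"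
      "\<forall>x y i. (x, y, i) \<in> F1 \<longrightarrow> (part x, part y, i) \<in> set ts \<longrightarrow>
           \<chi> (h x) (h y) = col (part x, part y, i)" using h2[OF \<chi>] by blast
    \<comment> \<open>The maps are found in the reverse order of construction: first
      \<open>h\<close> for the outer picture, then \<open>g\<close> for the recolouring pulled back
      along \<open>h\<close>.\<close>
    obtain g b where g: "\<forall>x. part (g x) = part x" "\<forall>x y j. (x, y, j) \<in> F \<longrightarrow> (g x, g y, j) \<in> F1"
      "\<forall>x y. (x, y, i) \<in> F \<longrightarrow> part x = p \<longrightarrow> part y = q \<longrightarrow> \<chi> (h (g x)) (h (g y)) = b"
      using h1[of "\<lambda>x y. \<chi> (h x) (h y)"] \<chi> by blast
    have "\<chi> (h (g x)) (h (g y)) = (col(a := b)) (part x, part y, j)"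
      if "(x, y, j) \<in> F" "(part x, part y, j) \<in> set (a # ts)" for x y j
    proof (cases "(part x, part y, j) = a")
      case True
      then show ?thesis using g(3) that a by auto
    next
      case False
      then have "(part (g x), part (g y), j) \<in> set ts" using that g(1) by simp
      then have "\<chi> (h (g x)) (h (g y)) = col (part (g x), part (g y), j)"
        using that g(2) h(3) by blast
      then show ?thesis using False g(1) by simp
    qed
    then show "\<exists>h col. (\<forall>x. part (h x) = part x) \<and> (\<forall>x y j. (x, y, j) \<in> F \<longrightarrow> (h x, h y, j) \<in> F') \<and>
        (\<forall>x y i. (x, y, i) \<in> F \<longrightarrow> (part x, part y, i) \<in> set (a # ts) \<longrightarrow>
           \<chi> (h x) (h y) = col (part x, part y, i))"
      using g(1,2) h(1,2)
      by (intro exI[of _ "\<lambda>x. h (g x)"] exI[of _ "col(a := b)"]) auto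
  qed
qed

text \<open>Once all pairs of parts are homogenised, the old-to-new colour map of a pair of parts is a
  colouring of pairs by functions \<open>{..<r} \<rightarrow> {..<r}\<close>, to which Ramsey's theorem applies.\<close>

theorem ordered_pattern_ramsey:
  assumes k: "k \<ge> 2"
  obtains F where "picture part r k F"
    and "\<forall>\<chi>. (\<forall>x y. \<chi> x y < r) \<longrightarrow>
      (\<exists>\<sigma>. \<forall>A. picture id r k A \<longrightarrow> (\<forall>u v i. (u, v, i) \<in> A \<longrightarrow> v < a) \<longrightarrow>
        (\<exists>\<phi>. \<forall>u v i. (u, v, i) \<in> A \<longrightarrow> (\<phi> u, \<phi> v, i) \<in> F \<and> \<chi> (\<phi> u) (\<phi> v) = \<sigma> i))"
proof -
  define AA where "AA = {A. picture id r k A \<and> (\<forall>u v i. (u, v, i) \<in> A \<longrightarrow> v < a)}"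
  have AD: "u < v" "v < a" "i < r" if "A \<in> AA" "(u, v, i) \<in> A" for A u v i
    using that pictureD(2,3)[of id r k A u v i] by (auto simp: AA_def)
  have "AA \<subseteq> Pow ({..<a} \<times> {..<a} \<times> {..<r})"
    using AD by (fastforce intro: less_trans)
  then have finAA: "finite AA" by (rule finite_subset) auto
  define K where "K = {..<r} \<rightarrow>\<^sub>E {..<r}"
  have finK: "finite K" unfolding K_def by (intro finite_PiE) auto
  obtain g :: "(nat \<Rightarrow> nat) \<Rightarrow> nat" and R where g: "inj_on g K" "g ` K = {..<R}"
    using finite_imp_inj_to_nat_seg[OF finK] by (auto simp: lessThan_def)
  \<comment> \<open>The parts are numbered below \<open>N\<close>; the Ramsey colours are the
    \<open>R\<close> functions in \<open>K\<close>, and a homogeneous set of \<open>a\<close> parts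
    is wanted.\<close>
  obtain N :: nat where N: "partn_lst {..<N} (replicate R a) 2"
    using ramsey_full by blast
  define SS where "SS = {S. S \<subseteq> {..<N} \<and> card S = a}"
  have "SS \<subseteq> Pow {..<N}" by (auto simp: SS_def)
  then have finSS: "finite SS" by (rule finite_subset) auto
  define e where "e S u = sorted_list_of_set S ! u" for S :: "nat set" and u
  have e: "e S u \<in> S" if "S \<in> SS" "u < a" for S u
  proof -
    have "finite S" using that finite_subset[of S "{..<N}"] by (auto simp: SS_def)
    then show ?thesis
      using that nth_mem[of u "sorted_list_of_set S"] by (simp add: SS_def e_def)
  qed
  have e_less: "e S u < e S v" if "S \<in> SS" "u < v" "v < a" for S u v
    using that sorted_wrt_nth_less[OF strict_sorted_list_of_set, of u v S]
    by (simp add: SS_def e_def)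
  define b where "b S A u = Base (e S u) S A" for S A u
  have inj_b: "u = v" if "b S A u = b S A v" "S \<in> SS" "u < a" "v < a" for S A u v
    using that e_less[of S u v] e_less[of S v u] by (cases u v rule: linorder_cases) (auto simp: b_def)
  \<comment> \<open>The first picture is a disjoint union: for each set \<open>S\<close> of
    \<open>a\<close> parts and each admissible \<open>A\<close>, one copy of \<open>A\<close> placed
    increasingly on \<open>S\<close>. Whichever \<open>S\<close> Ramsey's theorem yields, all the
    pictures \<open>A\<close> are present on it.\<close>
  define F where "F = (\<Union>S\<in>SS. \<Union>A\<in>AA. (\<lambda>(u, v, i). (b S A u, b S A v, i)) ` A)"
  have FI: "(b S A u, b S A v, i) \<in> F" if "S \<in> SS" "A \<in> AA" "(u, v, i) \<in> A" for S A u v i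
    using that unfolding F_def by force
  have FE: "\<exists>S\<in>SS. \<exists>A\<in>AA. \<exists>u v. x = b S A u \<and> y = b S A v \<and> (u, v, i) \<in> A"
    if "(x, y, i) \<in> F" for x y i
    using that unfolding F_def by force
  have bF: "(u, v, i) \<in> A" if F: "(b S A u, b S A v, i) \<in> F" and uv: "u < a" "v < a" for S A u v i
  proof -
    obtain S' A' u' v' where *: "S' \<in> SS" "A' \<in> AA" "b S A u = b S' A' u'" "b S A v = b S' A' v'"
      "(u', v', i) \<in> A'" using FE[OF F] by blast
    moreover have "S' = S" "A' = A" using * by (auto simp: b_def)
    moreover have "u' < a" "v' < a" using AD[of A' u' v' i] * by auto
    ultimately show ?thesis using inj_b[of S A u u'] inj_b[of S A v v'] uv by auto
  qed
  have picF: "picture part r k F"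
    unfolding picture_def
  proof (intro conjI allI impI notI)
    have "finite A" if "A \<in> AA" for A using that pictureD(1) by (auto simp: AA_def)
    then show "finite F" unfolding F_def using finSS finAA by blast
  next
    fix x y i assume "(x, y, i) \<in> F"
    from FE[OF this] obtain S A u v where *: "S \<in> SS" "A \<in> AA" "x = b S A u" "y = b S A v" "(u, v, i) \<in> A"
      by blast
    then show "part x < part y" "i < r"
      using AD[OF *(2,5)] e_less[of S u v] by (auto simp: b_def)
  next
    fix x y i j assume xy: "(x, y, i) \<in> F" "(x, y, j) \<in> F"
    obtain S A u v where *: "S \<in> SS" "A \<in> AA" "x = b S A u" "y = b S A v" "(u, v, i) \<in> A"
      using FE[OF xy(1)] by blast
    have "(u, v, j) \<in> A" by (rule bF[of S]) (use xy * AD[OF *(2,5)] in auto)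
    then show "i = j" using * pictureD(4) by (auto simp: AA_def)
  next
    fix i S'
    assume card: "card S' = k + 1"
      and cl: "\<forall>x\<in>S'. \<forall>y\<in>S'. x \<noteq> y \<longrightarrow> (x, y, i) \<in> F \<or> (y, x, i) \<in> F"
    have finS: "finite S'" using card card.infinite by fastforce
    obtain X where X: "X \<in> S'" using card by fastforce
    have "card (S' - {X}) = k" using card X finS by simp
    then obtain Y where Y: "Y \<in> S'" "Y \<noteq> X" using k
      by (metis card.empty not_numeral_le_zero Diff_iff insertI1 ex_in_conv)
    then have "(X, Y, i) \<in> F \<or> (Y, X, i) \<in> F" using cl X by blast
    then obtain S A x where S: "S \<in> SS" "A \<in> AA" and x: "X = b S A x" "x < a"
      using FE AD by (meson less_trans)
    \<comment> \<open>The tags \<open>S\<close> and \<open>A\<close> of \<open>X\<close> are shared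
      by its neighbours, so the clique lies in one copy.\<close>
    have "\<exists>z<a. Z = b S A z" if Z: "Z \<in> S'" for Z
    proof (cases "Z = X")
      case False
      then have "(X, Z, i) \<in> F \<or> (Z, X, i) \<in> F" using cl X Z by blast
      then obtain S2 A2 x2 z2 where *: "S2 \<in> SS" "A2 \<in> AA" "X = b S2 A2 x2" "Z = b S2 A2 z2" "z2 < a"
        using FE AD by (meson less_trans)
      then have "S2 = S" "A2 = A" using x by (auto simp: b_def)
      then show ?thesis using * by blast
    qed (use x in blast)
    then have "S' \<subseteq> b S A ` {..<a}" by blast
    then obtain S0 where S0: "S0 \<subseteq> {..<a}" "S' = b S A ` S0" by (auto elim: subset_imageE)
    have inj: "inj_on (b S A) {..<a}" using inj_b S by (auto intro: inj_onI)
    have "picture id r k A" using S by (simp add: AA_def)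
    moreover have "card S0 = k + 1" using card S0 card_image[OF inj_on_subset[OF inj S0(1)]] by simp
    ultimately show False
    proof (rule pictureD(5))
      fix y z assume yz: "y \<in> S0" "z \<in> S0" "y \<noteq> z"
      then have "b S A y \<noteq> b S A z" using inj S0 by (auto dest: inj_onD)
      then have "(b S A y, b S A z, i) \<in> F \<or> (b S A z, b S A y, i) \<in> F"
        using cl S0 yz by blast
      then show "(y, z, i) \<in> A \<or> (z, y, i) \<in> A" using bF yz S0(1) by blast
    qed
  qed
  have "finite {(p, q, i). p < q \<and> q < N \<and> i < r}"
    by (rule finite_subset[of _ "{..<N} \<times> {..<N} \<times> {..<r}"]) auto
  then obtain ts where ts: "set ts = {(p, q, i). p < q \<and> q < N \<and> i < r}"
    using finite_list by blast
  then have "\<forall>(p, q, i) \<in> set ts. p < q" by auto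
  from partite_iteration[OF picF k this]
  obtain F' where F': "picture part r k F'" and h: "\<And>\<chi>. \<forall>x y. \<chi> x y < r \<Longrightarrow>
      \<exists>h col. (\<forall>x. part (h x) = part x) \<and> (\<forall>x y j. (x, y, j) \<in> F \<longrightarrow> (h x, h y, j) \<in> F') \<and>
        (\<forall>x y i. (x, y, i) \<in> F \<longrightarrow> (part x, part y, i) \<in> set ts \<longrightarrow>
           \<chi> (h x) (h y) = col (part x, part y, i))" by blast
  have "\<exists>\<sigma>. \<forall>A. picture id r k A \<longrightarrow> (\<forall>u v i. (u, v, i) \<in> A \<longrightarrow> v < a) \<longrightarrow>
        (\<exists>\<phi>. \<forall>u v i. (u, v, i) \<in> A \<longrightarrow> (\<phi> u, \<phi> v, i) \<in> F' \<and> \<chi> (\<phi> u) (\<phi> v) = \<sigma> i)"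
    if \<chi>: "\<forall>x y. \<chi> x y < r" for \<chi>
  proof -
    have r: "r > 0" using \<chi> by (metis gr_implies_not_zero gr0I)
    obtain h col where h: "\<forall>x y j. (x, y, j) \<in> F \<longrightarrow> (h x, h y, j) \<in> F'"
      "\<forall>x y i. (x, y, i) \<in> F \<longrightarrow> (part x, part y, i) \<in> set ts \<longrightarrow>
           \<chi> (h x) (h y) = col (part x, part y, i)"
      using h[of \<chi>] \<chi> by blast
    \<comment> \<open>\<open>col\<close> is controlled only at triples that an edge of
      \<open>F\<close> realises. Reducing modulo \<open>r\<close> puts \<open>c p q\<close> into
      \<open>K\<close> in every case and changes nothing at those triples.\<close>
    define c where "c p q = restrict (\<lambda>i. col (p, q, i) mod r) {..<r}" for p q
    have cK: "c p q \<in> K" for p q using r by (auto simp: c_def K_def)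
    define f where "f s = g (c (Min s) (Max s))" for s
    have "f \<in> nsets {..<N} 2 \<rightarrow> {..<R}" using cK g(2) by (auto simp: f_def)
    then obtain m S where m: "m < R" and S: "S \<in> nsets {..<N} a" "f ` nsets S 2 \<subseteq> {m}"
      using N unfolding partn_lst_def monochromatic_def by fastforce
    have SS: "S \<in> SS" using S(1) by (auto simp: SS_def nsets_def)
    \<comment> \<open>The function numbered by the homogeneous colour \<open>m\<close>; it depends
      on \<open>S\<close> only, hence serves all \<open>A\<close> at once.\<close>
    define \<sigma> where "\<sigma> = inv_into K g m"
    have c\<sigma>: "c p q = \<sigma>" if "p \<in> S" "q \<in> S" "p < q" for p q
    proof -
      have "{p, q} \<in> nsets S 2" using that by (auto simp: nsets_def)
      then have "f {p, q} = m" using S(2) by blast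
      then have "g (c p q) = m" using that by (simp add: f_def)
      then show ?thesis using inv_into_f_f[OF g(1) cK] by (auto simp: \<sigma>_def)
    qed
    show ?thesis
    proof (intro exI[of _ \<sigma>] allI impI)
      fix A assume "picture id r k A" "\<forall>u v i. (u, v, i) \<in> A \<longrightarrow> v < a"
      then have A: "A \<in> AA" by (simp add: AA_def)
      have "(h (b S A u), h (b S A v), i) \<in> F' \<and> \<chi> (h (b S A u)) (h (b S A v)) = \<sigma> i"
        if uv: "(u, v, i) \<in> A" for u v i
      proof -
        have F: "(b S A u, b S A v, i) \<in> F" by (rule FI[OF SS A uv])
        have lt: "u < v" "v < a" "i < r" using AD[OF A uv] by auto
        have eS: "e S u \<in> S" "e S v \<in> S" "e S u < e S v"
          using lt SS by (auto intro: e e_less)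
        have "e S v < N" using eS SS by (auto simp: SS_def)
        then have "(e S u, e S v, i) \<in> set ts" using eS lt by (simp add: ts)
        then have *: "\<chi> (h (b S A u)) (h (b S A v)) = col (e S u, e S v, i)"
          using h(2) F by (auto simp: b_def)
        moreover have "col (e S u, e S v, i) < r" using * \<chi> by metis
        then have "c (e S u) (e S v) i = col (e S u, e S v, i)"
          using lt by (simp add: c_def)
        ultimately show ?thesis using h(1) F c\<sigma>[OF eS] by auto
      qed
      then show "\<exists>\<phi>. \<forall>u v i. (u, v, i) \<in> A \<longrightarrow> (\<phi> u, \<phi> v, i) \<in> F' \<and> \<chi> (\<phi> u) (\<phi> v) = \<sigma> i"
        by (intro exI[of _ "\<lambda>u. h (b S A u)"]) blast
    qed
  qed
  with F' show ?thesis using that by blast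
qed

section \<open>Cliques and colour patterns\<close>

lemma contains_copy_complete:
  "contains_copy V E (complete_graph m) \<longleftrightarrow>
     (\<exists>S\<subseteq>V. finite S \<and> card S = m \<and> (\<forall>x\<in>S. \<forall>y\<in>S. x \<noteq> y \<longrightarrow> {x, y} \<in> E))"
proof
  assume "contains_copy V E (complete_graph m)"
  then obtain f where f: "inj_on f {0..<m}" "f ` {0..<m} \<subseteq> V"
    and E: "\<forall>e\<in>snd (complete_graph m). f ` e \<in> E"
    unfolding contains_copy_def complete_graph_def by auto
  have "{f u, f v} \<in> E" if "u < m" "v < m" "f u \<noteq> f v" for u v
    using bspec[OF E, of "{u, v}"] that by (auto simp: complete_graph_def)
  with f show "\<exists>S\<subseteq>V. finite S \<and> card S = m \<and> (\<forall>x\<in>S. \<forall>y\<in>S. x \<noteq> y \<longrightarrow> {x, y} \<in> E)"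
    by (intro exI[of _ "f ` {0..<m}"]) (auto simp: card_image)
next
  assume "\<exists>S\<subseteq>V. finite S \<and> card S = m \<and> (\<forall>x\<in>S. \<forall>y\<in>S. x \<noteq> y \<longrightarrow> {x, y} \<in> E)"
  then obtain S where S: "S \<subseteq> V" "finite S" "card S = m"
    "\<forall>x\<in>S. \<forall>y\<in>S. x \<noteq> y \<longrightarrow> {x, y} \<in> E" by blast
  then obtain f where f: "bij_betw f {0..<m} S" using ex_bij_betw_nat_finite by metis
  have "f u \<noteq> f v" if "u < m" "v < m" "u \<noteq> v" for u v
    using f that by (auto simp: bij_betw_def dest: inj_onD)
  moreover have "f u \<in> S" if "u < m" for u using f that by (auto simp: bij_betw_def)
  ultimately show "contains_copy V E (complete_graph m)"
    unfolding contains_copy_def complete_graph_def using f S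
    by (intro exI[of _ f]) (auto simp: bij_betw_def)
qed

definition edges :: "('v \<times> 'v \<times> nat) set \<Rightarrow> 'v set set" where
  "edges F = {{x, y} | x y. \<exists>i. (x, y, i) \<in> F}"

lemma edgesI: "(x, y, i) \<in> F \<Longrightarrow> {x, y} \<in> edges F"
  by (auto simp: edges_def)

text \<open>Used to place a clique inside a vertex set: each of its vertices lies on one of its
  edges.\<close>

lemma clique_card_pair:
  assumes "card S = m" "m \<ge> 2" "x \<in> S"
  obtains y where "y \<in> S" "y \<noteq> x"
proof -
  have "S \<noteq> {x}" using assms by auto
  then show ?thesis using assms that by blast
qed

text \<open>The order of the naturals orients the edges, each vertex being its own part;
  edge-disjointness makes the colour of an edge unique.\<close>

lemma pattern_picture:
  assumes "finite V" "colour_pattern V r Gs" "pattern_free V r Gs (complete_graph (k + 1))" "k \<ge> 2"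
  shows "picture id r k {(u, v, i). u < v \<and> i < r \<and> {u, v} \<in> Gs i}" (is "picture _ _ _ ?A")
  unfolding picture_def
proof (intro conjI allI impI notI)
  have inV: "u \<in> V \<and> v \<in> V" if "{u, v} \<in> Gs i" "i < r" for u v i
    using assms(2) that unfolding colour_pattern_def graph_def by (metis doubleton_eq_iff)
  then have "?A \<subseteq> V \<times> V \<times> {..<r}" by auto
  then show "finite ?A" by (rule finite_subset) (use assms(1) in auto)
  fix i S
  assume card: "card S = k + 1"
    and cl: "\<forall>x\<in>S. \<forall>y\<in>S. x \<noteq> y \<longrightarrow> (x, y, i) \<in> ?A \<or> (y, x, i) \<in> ?A"
  have S: "{x, y} \<in> Gs i" "i < r" if "x \<in> S" "y \<in> S" "x \<noteq> y" for x y
    using cl that by (auto simp: insert_commute)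
  have card2: "k + 1 \<ge> 2" using assms(4) by simp
  have "x \<in> V \<and> i < r" if "x \<in> S" for x
    using clique_card_pair[OF card card2 that] S inV that by metis
  moreover have "finite S" "S \<noteq> {}" using card card.infinite by fastforce+
  ultimately have "i < r" "contains_copy V (Gs i) (complete_graph (k + 1))"
    using S card unfolding contains_copy_complete by (blast, blast)
  then show False using assms(3) by (auto simp: pattern_free_def)
qed (use assms(2) in \<open>auto simp: colour_pattern_def\<close>)

text \<open>Since \<open>k \<ge> 2\<close>, the vertex \<open>0\<close> sees both colours, towards
  \<open>1\<close> and towards \<open>2\<close>, so neither colour contains the whole
  clique.\<close>

lemma two_coloured_clique_picture:
  assumes "i < r" "j < r" "i \<noteq> j" "k \<ge> 2"
  shows "picture id r k {(u, v, if u = 0 \<and> v = 1 then i else j) | u v. u < v \<and> v \<le> k}"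
    (is "picture _ _ _ ?A")
  unfolding picture_def
proof (intro conjI allI impI notI)
  have "?A \<subseteq> {..k} \<times> {..k} \<times> {i, j}" by auto
  then show "finite ?A" by (rule finite_subset) auto
  fix c S
  assume card: "card S = k + 1"
    and cl: "\<forall>x\<in>S. \<forall>y\<in>S. x \<noteq> y \<longrightarrow> (x, y, c) \<in> ?A \<or> (y, x, c) \<in> ?A"
  have card2: "k + 1 \<ge> 2" using assms(4) by simp
  have "S \<subseteq> {..k}"
  proof
    fix x assume x: "x \<in> S"
    obtain y where "y \<in> S" "y \<noteq> x" by (rule clique_card_pair[OF card card2 x])
    then have "(x, y, c) \<in> ?A \<or> (y, x, c) \<in> ?A" using cl x by blast
    then show "x \<in> {..k}" by auto
  qed
  then have "S = {..k}" using card by (intro card_subset_eq) auto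
  then have in_S: "0 \<in> S" "1 \<in> S" "2 \<in> S" using assms(4) by auto
  have adj: "(x, y, c) \<in> ?A \<or> (y, x, c) \<in> ?A" if "x \<in> S" "y \<in> S" "x \<noteq> y" for x y
    using cl that by blast
  show False using adj[OF in_S(1,2)] adj[OF in_S(1,3)] assms(3) by simp
qed (use assms in auto)

section \<open>Forcing a packing pattern up to a permutation of the colours\<close>

text \<open>If \<open>c\<close> has no monochromatic clique on \<open>k + 1\<close> vertices, the
  two-coloured cliques make \<open>\<sigma>\<close> a permutation, and \<open>\<phi>\<close> carries
  the pattern into \<open>F\<close> with permuted colours. It may identify non-adjacent vertices,
  whence only \<open>card X \<le> card V\<close>, but it is injective on cliques, so strongly
  monochromatic cliques survive.\<close>

lemma pattern_forcing:
  assumes V: "finite V" and pat: "colour_pattern V r Gs"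
    and free: "pattern_free V r Gs (complete_graph (k + 1))"
    and strong: "\<forall>d. (\<forall>v\<in>V. d v < r) \<longrightarrow> strongly_mono_clique V r Gs d k"
    and k: "k \<ge> 2" and r: "r \<ge> 2"
  obtains F where "picture part r k F"
    and "\<forall>c. (\<forall>e. c e < r) \<longrightarrow>
      (\<exists>i<r. \<exists>S. card S = k + 1 \<and> (\<forall>x\<in>S. \<forall>y\<in>S. x \<noteq> y \<longrightarrow> {x, y} \<in> edges F \<and> c {x, y} = i)) \<or>
      (\<exists>X \<subseteq> \<Union>(edges F). finite X \<and> card X \<le> card V \<and> (\<forall>d. (\<forall>x\<in>X. d x < r) \<longrightarrow>
        (\<exists>i<r. \<exists>S\<subseteq>X. card S = k \<and> (\<forall>x\<in>S. d x = i) \<and>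
          (\<forall>x\<in>S. \<forall>y\<in>S. x \<noteq> y \<longrightarrow> {x, y} \<in> edges F \<and> c {x, y} = i))))"
proof -
  \<comment> \<open>Large enough for both kinds of picture: the pattern on \<open>V\<close> and the
    clique on \<open>{..k}\<close>.\<close>
  obtain a where "insert k V \<subseteq> {..<a}"
    using finite_nat_iff_bounded[of "insert k V"] V by auto
  then have a: "k < a" "V \<subseteq> {..<a}" by auto
  obtain F where F: "picture part r k F" and ram: "\<forall>\<chi>. (\<forall>x y. \<chi> x y < r) \<longrightarrow>
      (\<exists>\<sigma>. \<forall>A. picture id r k A \<longrightarrow> (\<forall>u v i. (u, v, i) \<in> A \<longrightarrow> v < a) \<longrightarrow>
        (\<exists>\<phi>. \<forall>u v i. (u, v, i) \<in> A \<longrightarrow> (\<phi> u, \<phi> v, i) \<in> F \<and> \<chi> (\<phi> u) (\<phi> v) = \<sigma> i))"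
    by (rule ordered_pattern_ramsey[OF k, of r a]) (rule that)
  let ?mono = "\<lambda>c. \<exists>i<r. \<exists>S. card S = k + 1 \<and>
    (\<forall>x\<in>S. \<forall>y\<in>S. x \<noteq> y \<longrightarrow> {x, y} \<in> edges F \<and> c {x, y} = i)"
  have "\<exists>X \<subseteq> \<Union>(edges F). finite X \<and> card X \<le> card V \<and> (\<forall>d. (\<forall>x\<in>X. d x < r) \<longrightarrow>
        (\<exists>i<r. \<exists>S\<subseteq>X. card S = k \<and> (\<forall>x\<in>S. d x = i) \<and>
          (\<forall>x\<in>S. \<forall>y\<in>S. x \<noteq> y \<longrightarrow> {x, y} \<in> edges F \<and> c {x, y} = i)))"
    if c: "\<forall>e. c e < r" and nm: "\<not> ?mono c" for c
  proof -
    have "c {x, y} < r" for x y using c by blast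
    from ram[rule_format, of "\<lambda>x y. c {x, y}", OF this]
    obtain \<sigma> where \<sigma>: "\<forall>A. picture id r k A \<longrightarrow> (\<forall>u v i. (u, v, i) \<in> A \<longrightarrow> v < a) \<longrightarrow>
        (\<exists>\<phi>. \<forall>u v i. (u, v, i) \<in> A \<longrightarrow> (\<phi> u, \<phi> v, i) \<in> F \<and> c {\<phi> u, \<phi> v} = \<sigma> i)"
      by (elim exE) (rule that)
    have gadget: "\<sigma> i \<noteq> \<sigma> j \<and> \<sigma> i < r" if ij: "i < r" "j < r" "i \<noteq> j" for i j
    proof -
      let ?A = "{(u, v, if u = 0 \<and> v = 1 then i else j) | u v. u < v \<and> v \<le> k}"
      obtain \<phi> where \<phi>: "\<forall>u v l. (u, v, l) \<in> ?A \<longrightarrow> (\<phi> u, \<phi> v, l) \<in> F \<and> c {\<phi> u, \<phi> v} = \<sigma> l"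
      proof -
        have "\<forall>u v l. (u, v, l) \<in> ?A \<longrightarrow> v < a" using a by auto
        from mp[OF mp[OF spec[OF \<sigma>] two_coloured_clique_picture[OF ij k]] this] show ?thesis by (elim exE) (rule that)
      qed
      have lt: "(\<phi> u, \<phi> v, if u = 0 \<and> v = 1 then i else j) \<in> F"
        "c {\<phi> u, \<phi> v} = \<sigma> (if u = 0 \<and> v = 1 then i else j)" if "u < v" "v \<le> k" for u v
        using \<phi> that by blast+
      have "c {\<phi> 0, \<phi> 1} = \<sigma> i" using lt(2)[of 0 1] k by simp
      then have ir: "\<sigma> i < r" using c by metis
      have "\<sigma> i \<noteq> \<sigma> j"
      proof
        \<comment> \<open>Equal values would make the image of the two-coloured clique monochromatic
          under \<open>c\<close>.\<close>
        assume eq: "\<sigma> i = \<sigma> j"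
        have ne: "\<phi> u \<noteq> \<phi> v" if "u < v" "v \<le> k" for u v
          using pictureD(2)[OF F lt(1)[OF that]] by auto
        have "inj_on \<phi> {..k}"
          by (rule inj_onI) (metis atMost_iff linorder_neqE_nat ne)
        then have "card (\<phi> ` {..k}) = k + 1" by (simp add: card_image)
        moreover have "{\<phi> u, \<phi> v} \<in> edges F \<and> c {\<phi> u, \<phi> v} = \<sigma> i" if "u \<le> k" "v \<le> k" "\<phi> u \<noteq> \<phi> v" for u v
        proof -
          have *: "{\<phi> u, \<phi> v} \<in> edges F \<and> c {\<phi> u, \<phi> v} = \<sigma> i" if "u < v" "v \<le> k" for u v
            using edgesI[OF lt(1)[OF that]] lt(2)[OF that] eq by auto
          show ?thesis using *[of u v] *[of v u] that
            by (cases u v rule: linorder_cases) (auto simp: insert_commute)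
        qed
        ultimately have "?mono c"
          by (intro exI[of _ "\<sigma> i"] conjI ir exI[of _ "\<phi> ` {..k}"]) auto
        then show False using nm by blast
      qed
      then show ?thesis using ir by blast
    qed
    have inj: "inj_on \<sigma> {..<r}"
      by (rule inj_onI) (metis gadget lessThan_iff)
    \<comment> \<open>\<open>gadget\<close> bounds \<open>\<sigma> i\<close> only in the presence of
      a second colour, which \<open>r \<ge> 2\<close> supplies.\<close>
    have "\<sigma> i < r" if "i < r" for i
    proof (cases "i = 0")
      case True
      then show ?thesis using gadget[of 0 1] r by simp
    next
      case False
      then show ?thesis using gadget[of i 0] that by simp
    qed
    then have surj: "\<sigma> ` {..<r} = {..<r}" using inj by (intro endo_inj_surj) auto
    let ?A = "{(u, v, i). u < v \<and> i < r \<and> {u, v} \<in> Gs i}"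
    have GV: "u \<in> V \<and> v \<in> V" if "{u, v} \<in> Gs i" "i < r" for u v i
      using pat that unfolding colour_pattern_def graph_def by (metis doubleton_eq_iff)
    obtain \<phi> where \<phi>: "\<forall>u v i. (u, v, i) \<in> ?A \<longrightarrow> (\<phi> u, \<phi> v, i) \<in> F \<and> c {\<phi> u, \<phi> v} = \<sigma> i"
    proof -
      have "\<forall>u v i. (u, v, i) \<in> ?A \<longrightarrow> v < a" using GV a(2) by fastforce
      from mp[OF mp[OF spec[OF \<sigma>] pattern_picture[OF V pat free k]] this] show ?thesis by (elim exE) (rule that)
    qed
    have \<phi>E: "\<phi> u \<noteq> \<phi> v \<and> {\<phi> u, \<phi> v} \<in> edges F \<and> c {\<phi> u, \<phi> v} = \<sigma> i"
      if "{u, v} \<in> Gs i" "i < r" "u \<noteq> v" for u v i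
    proof -
      have *: "\<phi> u \<noteq> \<phi> v \<and> {\<phi> u, \<phi> v} \<in> edges F \<and> c {\<phi> u, \<phi> v} = \<sigma> i"
        if "{u, v} \<in> Gs i" "i < r" "u < v" for u v
      proof -
        have "(\<phi> u, \<phi> v, i) \<in> F" "c {\<phi> u, \<phi> v} = \<sigma> i" using \<phi> that by blast+
        then show ?thesis using edgesI[of "\<phi> u"] pictureD(2)[OF F, of "\<phi> u" "\<phi> v" i] by auto
      qed
      show ?thesis using *[of u v] *[of v u] that
        by (cases u v rule: linorder_cases) (auto simp: insert_commute)
    qed
    \<comment> \<open>Isolated vertices are dropped, since nothing is known about their images under
      \<open>\<phi>\<close>.\<close>
    define V' where "V' = {u. \<exists>v i. u \<noteq> v \<and> i < r \<and> {u, v} \<in> Gs i}"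
    have V'V: "V' \<subseteq> V" using GV by (auto simp: V'_def)
    then have finV': "finite V'" using V finite_subset by blast
    have "card (\<phi> ` V') \<le> card V"
      using card_image_le[OF finV', of \<phi>] card_mono[OF V V'V] by simp
    moreover have "\<phi> ` V' \<subseteq> \<Union>(edges F)"
      using \<phi>E unfolding V'_def by blast
    moreover have "\<exists>i<r. \<exists>S\<subseteq>\<phi> ` V'. card S = k \<and> (\<forall>x\<in>S. d x = i) \<and>
          (\<forall>x\<in>S. \<forall>y\<in>S. x \<noteq> y \<longrightarrow> {x, y} \<in> edges F \<and> c {x, y} = i)"
      if d: "\<forall>x\<in>\<phi> ` V'. d x < r" for d
    proof -
      \<comment> \<open>The colouring \<open>d\<close> is pulled back along \<open>\<phi>\<close>
        and the inverse of \<open>\<sigma>\<close>. The default \<open>0\<close> on isolated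
        vertices is harmless: a clique on \<open>k \<ge> 2\<close> vertices avoids them.\<close>
      let ?d = "\<lambda>v. if v \<in> V' then inv_into {..<r} \<sigma> (d (\<phi> v)) else 0"
      have d': "?d v < r \<and> (v \<in> V' \<longrightarrow> \<sigma> (?d v) = d (\<phi> v))" for v
        using d surj r inv_into_into[of "d (\<phi> v)" \<sigma> "{..<r}"] f_inv_into_f[of "d (\<phi> v)" \<sigma> "{..<r}"]
        by auto
      then have "strongly_mono_clique V r Gs ?d k" by (intro mp[OF spec[OF strong]]) blast
      then obtain i S where i: "i < r" and S: "S \<subseteq> V" "card S = k" "\<forall>v\<in>S. ?d v = i"
        "\<forall>u\<in>S. \<forall>v\<in>S. u \<noteq> v \<longrightarrow> {u, v} \<in> Gs i"
        unfolding strongly_mono_clique_def by blast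
      have SV': "S \<subseteq> V'"
      proof
        fix x assume x: "x \<in> S"
        obtain y where y: "y \<in> S" "y \<noteq> x" using clique_card_pair[OF S(2) k x] .
        have "{x, y} \<in> Gs i" using bspec[OF bspec[OF S(4) x] y(1)] y(2) by simp
        then show "x \<in> V'" unfolding V'_def using i y by auto
      qed
      have E: "\<phi> u \<noteq> \<phi> v \<and> {\<phi> u, \<phi> v} \<in> edges F \<and> c {\<phi> u, \<phi> v} = \<sigma> i"
        if "u \<in> S" "v \<in> S" "u \<noteq> v" for u v
      proof (rule \<phi>E[of u v i])
        show "{u, v} \<in> Gs i" using bspec[OF bspec[OF S(4) that(1)] that(2)] that(3) by simp
      qed (use i that in auto)
      then have "inj_on \<phi> S" by (auto intro: inj_onI)
      then have "card (\<phi> ` S) = k" using S(2) by (simp add: card_image)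
      moreover have "d (\<phi> v) = \<sigma> i" if "v \<in> S" for v
        using d'[of v] bspec[OF S(3) that] subsetD[OF SV' that] by simp
      moreover have "\<sigma> i < r" using equalityD1[OF surj] i by (auto simp: image_subset_iff)
      moreover have "{\<phi> u, \<phi> v} \<in> edges F \<and> c {\<phi> u, \<phi> v} = \<sigma> i"
        if "u \<in> S" "v \<in> S" "\<phi> u \<noteq> \<phi> v" for u v
        using E[OF that(1,2)] that(3) by (cases "u = v") simp_all
      ultimately show ?thesis using SV'
        by (intro exI[of _ "\<sigma> i"] conjI exI[of _ "\<phi> ` S"]) auto
    qed
    ultimately show ?thesis using finV' by (intro exI[of _ "\<phi> ` V'"]) simp
  qed
  note main = this
  show ?thesis
  proof (rule that[OF F], intro allI impI, subst disj_commute, rule disjCI)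
    fix c :: "vtx set \<Rightarrow> nat"
    assume c: "\<forall>e. c e < r" and "\<not> ?mono c"
    then show "\<exists>X \<subseteq> \<Union>(edges F). finite X \<and> card X \<le> card V \<and> (\<forall>d. (\<forall>x\<in>X. d x < r) \<longrightarrow>
        (\<exists>i<r. \<exists>S\<subseteq>X. card S = k \<and> (\<forall>x\<in>S. d x = i) \<and>
          (\<forall>x\<in>S. \<forall>y\<in>S. x \<noteq> y \<longrightarrow> {x, y} \<in> edges F \<and> c {x, y} = i)))"
      by (rule main)
  qed
qed

section \<open>Ramsey-minimal graphs\<close>

text \<open>Transfers the forcing picture to a graph on an initial segment of the naturals. The
  colours of the picture itself witness that this graph is not Ramsey.\<close>

lemma clique_packing_graph:
  assumes V: "finite V" and pat: "colour_pattern V r Gs"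
    and free: "pattern_free V r Gs (complete_graph (k + 1))"
    and strong: "\<forall>d. (\<forall>v\<in>V. d v < r) \<longrightarrow> strongly_mono_clique V r Gs d k"
    and k: "k \<ge> 2" and r: "r \<ge> 2"
  obtains w E where "graph {..<w} E" "\<not> arrows {..<w} E (complete_graph (k + 1)) r"
    and "\<forall>c. (\<forall>e. c e < r) \<longrightarrow>
      (\<exists>i<r. contains_copy {..<w} {e \<in> E. c e = i} (complete_graph (k + 1))) \<or>
      (\<exists>X \<subseteq> {..<w}. card X \<le> card V \<and> (\<forall>d. (\<forall>x\<in>X. d x < r) \<longrightarrow>
        (\<exists>i<r. \<exists>S\<subseteq>X. card S = k \<and> (\<forall>x\<in>S. d x = i) \<and>
          (\<forall>x\<in>S. \<forall>y\<in>S. x \<noteq> y \<longrightarrow> {x, y} \<in> E \<and> c {x, y} = i))))"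
proof -
  obtain F where F: "picture part r k F"
    and force: "\<forall>c. (\<forall>e. c e < r) \<longrightarrow>
      (\<exists>i<r. \<exists>S. card S = k + 1 \<and> (\<forall>x\<in>S. \<forall>y\<in>S. x \<noteq> y \<longrightarrow> {x, y} \<in> edges F \<and> c {x, y} = i)) \<or>
      (\<exists>X \<subseteq> \<Union>(edges F). finite X \<and> card X \<le> card V \<and> (\<forall>d. (\<forall>x\<in>X. d x < r) \<longrightarrow>
        (\<exists>i<r. \<exists>S\<subseteq>X. card S = k \<and> (\<forall>x\<in>S. d x = i) \<and>
          (\<forall>x\<in>S. \<forall>y\<in>S. x \<noteq> y \<longrightarrow> {x, y} \<in> edges F \<and> c {x, y} = i))))"
    using pattern_forcing[OF V pat free strong k r] .
  let ?W = "\<Union>(edges F)"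
  have "edges F = (\<lambda>(x, y, i). {x, y}) ` F" by (force simp: edges_def)
  then have "finite ?W" using pictureD(1)[OF F] by auto
  then obtain \<iota> :: "vtx \<Rightarrow> nat" and w where \<iota>: "inj_on \<iota> ?W" "\<iota> ` ?W = {..<w}"
    using finite_imp_inj_to_nat_seg[of ?W] by (auto simp: lessThan_def)
  define E where "E = (`) \<iota> ` edges F"
  have EI: "{\<iota> x, \<iota> y} \<in> E" if "{x, y} \<in> edges F" for x y
    using imageI[OF that, of "(`) \<iota>"] by (simp add: E_def)
  have edgeE: "\<exists>x y i. (x, y, i) \<in> F \<and> e = {\<iota> x, \<iota> y} \<and> x \<in> ?W \<and> y \<in> ?W \<and> \<iota> x \<noteq> \<iota> y"
    if e: "e \<in> E" for e
  proof -
    obtain x y i where *: "(x, y, i) \<in> F" "e = \<iota> ` {x, y}"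
      using e unfolding E_def edges_def by blast
    moreover have "x \<in> ?W" "y \<in> ?W" using edgesI[OF *(1)] by blast+
    moreover have "x \<noteq> y" using pictureD(2)[OF F *(1)] by auto
    ultimately show ?thesis using inj_onD[OF \<iota>(1), of x y]
      by (intro exI[of _ x] exI[of _ y] exI[of _ i]) auto
  qed
  have gr: "graph {..<w} E"
    unfolding graph_def
  proof (intro conjI ballI)
    fix e assume "e \<in> E"
    then show "\<exists>u v. u \<in> {..<w} \<and> v \<in> {..<w} \<and> u \<noteq> v \<and> e = {u, v}"
      using edgeE \<iota>(2) by blast
  qed simp
  define col where "col e = (SOME i. \<exists>x y. (x, y, i) \<in> F \<and> e = {\<iota> x, \<iota> y})" for e
  have col: "\<exists>x y. (x, y, col e) \<in> F \<and> e = {\<iota> x, \<iota> y}" if "e \<in> E" for e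
    unfolding col_def by (rule someI_ex) (use edgeE[OF that] in blast)
  have na: "\<not> arrows {..<w} E (complete_graph (k + 1)) r"
  proof
    assume "arrows {..<w} E (complete_graph (k + 1)) r"
    moreover have "\<forall>e\<in>E. col e < r" using col pictureD(3)[OF F] by blast
    ultimately obtain i where "contains_copy {..<w} {e \<in> E. col e = i} (complete_graph (k + 1))"
      unfolding arrows_def by blast
    then obtain S where S: "S \<subseteq> {..<w}" "card S = k + 1"
      and cl: "\<And>x y. x \<in> S \<Longrightarrow> y \<in> S \<Longrightarrow> x \<noteq> y \<Longrightarrow> {x, y} \<in> E \<and> col {x, y} = i"
      unfolding contains_copy_complete by auto
    have "S \<subseteq> \<iota> ` ?W" using S(1) \<iota>(2) by simp
    then obtain S0 where S0: "S0 \<subseteq> ?W" "S = \<iota> ` S0" by (auto elim: subset_imageE)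
    have inj: "inj_on \<iota> S0" by (rule inj_on_subset[OF \<iota>(1) S0(1)])
    have "card S0 = k + 1" using S(2) S0(2) card_image[OF inj] by simp
    then show False
    proof (rule pictureD(5)[OF F])
      fix x y assume xy: "x \<in> S0" "y \<in> S0" "x \<noteq> y"
      then have "\<iota> x \<noteq> \<iota> y" using inj_onD[OF inj] by blast
      then have E: "{\<iota> x, \<iota> y} \<in> E" "col {\<iota> x, \<iota> y} = i" using cl[of "\<iota> x" "\<iota> y"] S0(2) xy by auto
      obtain x' y' where *: "(x', y', i) \<in> F" "{\<iota> x, \<iota> y} = {\<iota> x', \<iota> y'}"
        using col[OF E(1)] E(2) by metis
      moreover have "x' \<in> ?W" "y' \<in> ?W" using edgesI[OF *(1)] by blast+
      moreover have "x \<in> ?W" "y \<in> ?W" using xy S0(1) by blast+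
      moreover have "\<iota> x = \<iota> x' \<and> \<iota> y = \<iota> y' \<or> \<iota> x = \<iota> y' \<and> \<iota> y = \<iota> x'"
        using *(2) by (simp add: doubleton_eq_iff)
      ultimately show "(x, y, i) \<in> F \<or> (y, x, i) \<in> F" using inj_onD[OF \<iota>(1)] by metis
    qed
  qed
  show ?thesis
  proof (rule that[OF gr na], intro allI impI)
    fix c :: "nat set \<Rightarrow> nat" assume c: "\<forall>e. c e < r"
    \<comment> \<open>Recolourings are pulled back along \<open>\<iota>\<close> to apply the forcing
      property.\<close>
    have "\<forall>e. c (\<iota> ` e) < r" using c by blast
    from mp[OF spec[OF force] this]
    show "(\<exists>i<r. contains_copy {..<w} {e \<in> E. c e = i} (complete_graph (k + 1))) \<or>
      (\<exists>X \<subseteq> {..<w}. card X \<le> card V \<and> (\<forall>d. (\<forall>x\<in>X. d x < r) \<longrightarrow>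
        (\<exists>i<r. \<exists>S\<subseteq>X. card S = k \<and> (\<forall>x\<in>S. d x = i) \<and>
          (\<forall>x\<in>S. \<forall>y\<in>S. x \<noteq> y \<longrightarrow> {x, y} \<in> E \<and> c {x, y} = i))))"
    proof (rule disj_forward)
      assume "\<exists>i<r. \<exists>S. card S = k + 1 \<and>
        (\<forall>x\<in>S. \<forall>y\<in>S. x \<noteq> y \<longrightarrow> {x, y} \<in> edges F \<and> c (\<iota> ` {x, y}) = i)"
      then obtain i S where i: "i < r" and card: "card S = k + 1"
        and cl: "\<And>x y. x \<in> S \<Longrightarrow> y \<in> S \<Longrightarrow> x \<noteq> y \<Longrightarrow> {x, y} \<in> edges F \<and> c {\<iota> x, \<iota> y} = i"
        by auto
      have card2: "k + 1 \<ge> 2" using k by simp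
      have SW: "S \<subseteq> ?W"
      proof
        fix x assume x: "x \<in> S"
        obtain y where "y \<in> S" "y \<noteq> x" using clique_card_pair[OF card card2 x] .
        then show "x \<in> ?W" using cl[OF x] by blast
      qed
      have "card (\<iota> ` S) = k + 1" using card card_image[OF inj_on_subset[OF \<iota>(1) SW]] by simp
      moreover have "\<iota> ` S \<subseteq> {..<w}" using SW \<iota>(2) by blast
      moreover have "finite (\<iota> ` S)" using card card.infinite by fastforce
      moreover have "{\<iota> x, \<iota> y} \<in> E \<and> c {\<iota> x, \<iota> y} = i" if "x \<in> S" "y \<in> S" "\<iota> x \<noteq> \<iota> y" for x y
        using cl[of x y] that EI by (cases "x = y") auto
      ultimately have "contains_copy {..<w} {e \<in> E. c e = i} (complete_graph (k + 1))"
        unfolding contains_copy_complete by (intro exI[of _ "\<iota> ` S"]) auto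
      then show "\<exists>i<r. contains_copy {..<w} {e \<in> E. c e = i} (complete_graph (k + 1))"
        using i by blast
    next
      assume "\<exists>X \<subseteq> ?W. finite X \<and> card X \<le> card V \<and> (\<forall>d. (\<forall>x\<in>X. d x < r) \<longrightarrow>
        (\<exists>i<r. \<exists>S\<subseteq>X. card S = k \<and> (\<forall>x\<in>S. d x = i) \<and>
          (\<forall>x\<in>S. \<forall>y\<in>S. x \<noteq> y \<longrightarrow> {x, y} \<in> edges F \<and> c (\<iota> ` {x, y}) = i)))"
      then obtain X where X: "X \<subseteq> ?W" "finite X" "card X \<le> card V"
        and d: "\<forall>d. (\<forall>x\<in>X. d x < r) \<longrightarrow>
          (\<exists>i<r. \<exists>S\<subseteq>X. card S = k \<and> (\<forall>x\<in>S. d x = i) \<and>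
          (\<forall>x\<in>S. \<forall>y\<in>S. x \<noteq> y \<longrightarrow> {x, y} \<in> edges F \<and> c (\<iota> ` {x, y}) = i))"
        by blast
      have inj: "inj_on \<iota> X" by (rule inj_on_subset[OF \<iota>(1) X(1)])
      have "\<exists>i<r. \<exists>S\<subseteq>\<iota> ` X. card S = k \<and> (\<forall>x\<in>S. d x = i) \<and>
          (\<forall>x\<in>S. \<forall>y\<in>S. x \<noteq> y \<longrightarrow> {x, y} \<in> E \<and> c {x, y} = i)"
        if dX: "\<forall>x\<in>\<iota> ` X. d x < r" for d
      proof -
        have "\<forall>x\<in>X. d (\<iota> x) < r" using dX by blast
        then obtain i S where i: "i < r" and S: "S \<subseteq> X" "card S = k" "\<forall>x\<in>S. d (\<iota> x) = i"
          and cl: "\<forall>x\<in>S. \<forall>y\<in>S. x \<noteq> y \<longrightarrow> {x, y} \<in> edges F \<and> c (\<iota> ` {x, y}) = i"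
          using d[rule_format, of "\<lambda>x. d (\<iota> x)"] by auto
        have "card (\<iota> ` S) = k" using S(2) card_image[OF inj_on_subset[OF inj S(1)]] by simp
        moreover have "{\<iota> x, \<iota> y} \<in> E \<and> c {\<iota> x, \<iota> y} = i" if "x \<in> S" "y \<in> S" "\<iota> x \<noteq> \<iota> y" for x y
          using bspec[OF bspec[OF cl that(1)] that(2)] that EI by (cases "x = y") auto
        ultimately show ?thesis using i S(1,3)
          by (intro exI[of _ i] conjI exI[of _ "\<iota> ` S"]) auto
      qed
      moreover have "\<iota> ` X \<subseteq> {..<w}" using X(1) \<iota>(2) by blast
      moreover have "card (\<iota> ` X) \<le> card V" using X(3) card_image[OF inj] by simp
      ultimately show "\<exists>X \<subseteq> {..<w}. card X \<le> card V \<and> (\<forall>d. (\<forall>x\<in>X. d x < r) \<longrightarrow>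
        (\<exists>i<r. \<exists>S\<subseteq>X. card S = k \<and> (\<forall>x\<in>S. d x = i) \<and>
          (\<forall>x\<in>S. \<forall>y\<in>S. x \<noteq> y \<longrightarrow> {x, y} \<in> E \<and> c {x, y} = i)))"
        by (intro exI[of _ "\<iota> ` X"]) simp
    qed
  qed
qed

section \<open>Passing to minimal Ramsey subgraphs\<close>

lemma contains_copy_mono:
  assumes "contains_copy V E H" "V \<subseteq> V'" "E \<subseteq> E'"
  shows "contains_copy V' E' H"
  using assms unfolding contains_copy_def by (meson order_trans subsetD)

lemma arrows_mono:
  assumes "arrows V E H r" "V \<subseteq> V'" "E \<subseteq> E'"
  shows "arrows V' E' H r"
  unfolding arrows_def
proof (intro allI impI)
  fix c :: "nat set \<Rightarrow> nat" assume "\<forall>e\<in>E'. c e < r"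
  then have "\<forall>e\<in>E. c e < r" using assms(3) by blast
  then obtain i where "i < r" "contains_copy V {e \<in> E. c e = i} H"
    using assms(1) unfolding arrows_def by blast
  moreover have "{e \<in> E. c e = i} \<subseteq> {e \<in> E'. c e = i}" using assms(3) by blast
  ultimately show "\<exists>i<r. contains_copy V' {e \<in> E'. c e = i} H"
    using contains_copy_mono assms(2) by blast
qed

lemma finite_edges:
  assumes "graph V E"
  shows "finite E"
proof -
  have "E \<subseteq> Pow V" using assms by (auto simp: graph_def)
  then show ?thesis using assms finite_subset by (auto simp: graph_def)
qed

text \<open>Descent on the number of vertices plus edges, which drops for every proper
  subgraph.\<close>

lemma ex_ramsey_minimal:
  assumes "graph V E" "arrows V E H r"
  obtains V' E' where "V' \<subseteq> V" "E' \<subseteq> E" "ramsey_minimal r H V' E'"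
  using assms
proof (induction "card V + card E" arbitrary: V E thesis rule: less_induct)
  case less
  show ?case
  proof (cases "ramsey_minimal r H V E")
    case True
    then show ?thesis using less.prems(1)[of V E] by simp
  next
    case False
    then obtain V1 E1 where 1: "graph V1 E1" "V1 \<subseteq> V" "E1 \<subseteq> E" "(V1, E1) \<noteq> (V, E)" "arrows V1 E1 H r"
      using less.prems(2,3) unfolding ramsey_minimal_def by blast
    have fin: "finite V" "finite E"
      using less.prems(2) finite_edges by (auto simp: graph_def)
    have "card V1 \<le> card V" "card E1 \<le> card E" using 1 fin card_mono by auto
    moreover have "V1 \<subset> V \<or> E1 \<subset> E" using 1 by blast
    then have "card V1 < card V \<or> card E1 < card E" using fin by (auto intro: psubset_card_mono)
    ultimately have "card V1 + card E1 < card V + card E" by linarith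
    then show ?thesis
    proof (rule less.hyps[OF _ _ 1(1,5)])
      fix V' E' assume sub: "V' \<subseteq> V1" "E' \<subseteq> E1" and min: "ramsey_minimal r H V' E'"
      show ?thesis
        by (rule less.prems(1)[OF subset_trans[OF sub(1) 1(2)] subset_trans[OF sub(2) 1(3)] min])
    qed
  qed
qed

lemma min_degree_le:
  assumes "graph V E" "v \<in> V"
  shows "min_degree V E \<le> degree E v"
  using assms unfolding min_degree_def graph_def by (intro Min_le) auto

section \<open>From a packing pattern to a Ramsey-minimal graph of small minimum degree\<close>

text \<open>The colours of the edges from an added vertex to \<open>X\<close> form a vertex
  colouring of \<open>X\<close>; a strongly monochromatic clique for it, together with the added
  vertex, is a monochromatic clique on \<open>k + 1\<close> vertices.\<close>

lemma ramsey_minimal_of_packing: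
  assumes V: "finite V" and pat: "colour_pattern V r Gs"
    and free: "pattern_free V r Gs (complete_graph (k + 1))"
    and strong: "\<forall>d. (\<forall>v\<in>V. d v < r) \<longrightarrow> strongly_mono_clique V r Gs d k"
    and k: "k \<ge> 2" and r: "r \<ge> 2"
  obtains V' E' where "ramsey_minimal r (complete_graph (k + 1)) V' E'" "min_degree V' E' \<le> card V"
proof -
  let ?K = "complete_graph (k + 1)"
  obtain w E where gr: "graph {..<w} E" and na: "\<not> arrows {..<w} E ?K r"
    and force: "\<forall>c. (\<forall>e. c e < r) \<longrightarrow>
      (\<exists>i<r. contains_copy {..<w} {e \<in> E. c e = i} ?K) \<or>
      (\<exists>X \<subseteq> {..<w}. card X \<le> card V \<and> (\<forall>d. (\<forall>x\<in>X. d x < r) \<longrightarrow>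
        (\<exists>i<r. \<exists>S\<subseteq>X. card S = k \<and> (\<forall>x\<in>S. d x = i) \<and>
          (\<forall>x\<in>S. \<forall>y\<in>S. x \<noteq> y \<longrightarrow> {x, y} \<in> E \<and> c {x, y} = i))))"
    using clique_packing_graph[OF V pat free strong k r] .
  \<comment> \<open>The forced set depends on the edge colouring, so every candidate gets its own
    added vertex.\<close>
  define XX where "XX = {X. X \<subseteq> {..<w} \<and> card X \<le> card V}"
  have finX: "finite X" if "X \<in> XX" for X
    using that finite_subset[of X "{..<w}"] by (auto simp: XX_def)
  have "finite XX" by (rule finite_subset[of _ "Pow {..<w}"]) (auto simp: XX_def)
  \<comment> \<open>\<open>set_encode\<close> is injective on finite sets, and the shift by
    \<open>w\<close> keeps the new vertices off the old ones.\<close>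
  define apex where "apex X = w + set_encode X" for X
  define V1 where "V1 = {..<w} \<union> apex ` XX"
  define E1 where "E1 = E \<union> {{x, apex X} | x X. X \<in> XX \<and> x \<in> X}"
  have Ew: "e \<subseteq> {..<w}" if "e \<in> E" for e using gr that by (auto simp: graph_def)
  have gr1: "graph V1 E1"
    unfolding graph_def
  proof (intro conjI ballI)
    show "finite V1" using \<open>finite XX\<close> by (simp add: V1_def)
    fix e assume "e \<in> E1"
    then consider "e \<in> E" | x X where "e = {x, apex X}" "X \<in> XX" "x \<in> X"
      unfolding E1_def by blast
    then show "\<exists>u v. u \<in> V1 \<and> v \<in> V1 \<and> u \<noteq> v \<and> e = {u, v}"
    proof cases
      case 1
      then show ?thesis using gr unfolding graph_def V1_def by blast
    next
      case 2
      then have "x < w" by (auto simp: XX_def)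
      then show ?thesis using 2
        by (intro exI[of _ x] exI[of _ "apex X"]) (auto simp: V1_def apex_def)
    qed
  qed
  have arr1: "arrows V1 E1 ?K r"
    unfolding arrows_def
  proof (intro allI impI)
    fix c :: "nat set \<Rightarrow> nat" assume c: "\<forall>e\<in>E1. c e < r"
    \<comment> \<open>The forcing property asks for a bound on all sets, not only on edges, hence
      the default \<open>0\<close>.\<close>
    define c' where "c' e = (if e \<in> E1 then c e else 0)" for e
    have c': "\<forall>e. c' e < r" using c r by (simp add: c'_def)
    have c'E: "c e = c' e" if "e \<in> E" for e using that by (simp add: c'_def E1_def)
    from mp[OF spec[OF force] c'] show "\<exists>i<r. contains_copy V1 {e \<in> E1. c e = i} ?K"
    proof (elim disjE)
      assume "\<exists>i<r. contains_copy {..<w} {e \<in> E. c' e = i} ?K"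
      then obtain i where "i < r" "contains_copy {..<w} {e \<in> E. c' e = i} ?K" by blast
      moreover have "{e \<in> E. c' e = i} \<subseteq> {e \<in> E1. c e = i}" by (auto simp: c'E E1_def)
      ultimately show ?thesis
        using contains_copy_mono[of "{..<w}" _ ?K V1] by (auto simp: V1_def)
    next
      assume "\<exists>X \<subseteq> {..<w}. card X \<le> card V \<and> (\<forall>d. (\<forall>x\<in>X. d x < r) \<longrightarrow>
        (\<exists>i<r. \<exists>S\<subseteq>X. card S = k \<and> (\<forall>x\<in>S. d x = i) \<and>
          (\<forall>x\<in>S. \<forall>y\<in>S. x \<noteq> y \<longrightarrow> {x, y} \<in> E \<and> c' {x, y} = i)))"
      then obtain X where X: "X \<in> XX" and d: "\<forall>d. (\<forall>x\<in>X. d x < r) \<longrightarrow>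
        (\<exists>i<r. \<exists>S\<subseteq>X. card S = k \<and> (\<forall>x\<in>S. d x = i) \<and>
          (\<forall>x\<in>S. \<forall>y\<in>S. x \<noteq> y \<longrightarrow> {x, y} \<in> E \<and> c' {x, y} = i))"
        unfolding XX_def by blast
      obtain i S where i: "i < r" and S: "S \<subseteq> X" "card S = k" "\<forall>x\<in>S. c' {x, apex X} = i"
        and cl: "\<forall>x\<in>S. \<forall>y\<in>S. x \<noteq> y \<longrightarrow> {x, y} \<in> E \<and> c' {x, y} = i"
        using d[rule_format, of "\<lambda>x. c' {x, apex X}"] c' by auto
      have apexE: "{x, apex X} \<in> E1" "{apex X, x} \<in> E1" if "x \<in> S" for x
        using that S(1) X by (auto simp: E1_def)
      then have apexc: "c {x, apex X} = i" "c {apex X, x} = i" if "x \<in> S" for x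
        using that S(3) by (auto simp: c'_def insert_commute)
      have finS: "finite S" using S(1) finX[OF X] finite_subset by blast
      have Sw: "S \<subseteq> {..<w}" using S(1) X by (auto simp: XX_def)
      then have "apex X \<notin> S" by (auto simp: apex_def)
      then have card: "card (insert (apex X) S) = k + 1" using S(2) finS by simp
      have sub: "insert (apex X) S \<subseteq> V1" using Sw X by (auto simp: V1_def)
      have "{x, y} \<in> E1 \<and> c {x, y} = i" if "x \<in> S" "y \<in> S" "x \<noteq> y" for x y
        using bspec[OF bspec[OF cl that(1)] that(2)] that(3) c'E by (auto simp: E1_def)
      then have "contains_copy V1 {e \<in> E1. c e = i} ?K"
        unfolding contains_copy_complete
        using card sub finS apexE apexc by (intro exI[of _ "insert (apex X) S"]) auto
      then show ?thesis using i by blast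
    qed
  qed
  obtain V2 E2 where 2: "V2 \<subseteq> V1" "E2 \<subseteq> E1" and min: "ramsey_minimal r ?K V2 E2"
    using ex_ramsey_minimal[OF gr1 arr1] .
  have gr2: "graph V2 E2" and arr2: "arrows V2 E2 ?K r"
    using min by (auto simp: ramsey_minimal_def)
  \<comment> \<open>Without an added vertex the minimal graph would lie inside the non-Ramsey graph
    \<open>E\<close>.\<close>
  have "\<exists>X\<in>XX. apex X \<in> V2"
  proof (rule ccontr)
    assume no: "\<not> (\<exists>X\<in>XX. apex X \<in> V2)"
    then have "V2 \<subseteq> {..<w}" using 2(1) unfolding V1_def by blast
    moreover have "E2 \<subseteq> E"
    proof
      fix e assume e: "e \<in> E2"
      then have "e \<subseteq> V2" using gr2 by (auto simp: graph_def)
      then show "e \<in> E" using e 2(2) no unfolding E1_def by blast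
    qed
    ultimately show False using arrows_mono[OF arr2] na by blast
  qed
  then obtain X where X: "X \<in> XX" "apex X \<in> V2" by blast
  have "e \<in> (\<lambda>x. {x, apex X}) ` X" if e: "e \<in> E2" "apex X \<in> e" for e
  proof -
    have "e \<notin> E" using Ew e(2) by (fastforce simp: apex_def)
    then obtain x Y where Y: "e = {x, apex Y}" "Y \<in> XX" "x \<in> Y"
      using e 2(2) unfolding E1_def by blast
    have "x < w" using Y by (auto simp: XX_def)
    then have "apex X = apex Y" using e(2) Y(1) by (auto simp: apex_def)
    then have "X = Y" using set_encode_eq[OF finX[OF X(1)] finX[OF Y(2)]] by (simp add: apex_def)
    then show ?thesis using Y by blast
  qed
  then have "{e \<in> E2. apex X \<in> e} \<subseteq> (\<lambda>x. {x, apex X}) ` X" by blast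
  then have "degree E2 (apex X) \<le> card X"
    unfolding degree_def using surj_card_le[OF finX[OF X(1)]] by blast
  also have "card X \<le> card V" using X(1) by (simp add: XX_def)
  finally show ?thesis using min_degree_le[OF gr2 X(2)] that[OF min] by linarith
qed

section \<open>From a Ramsey-minimal graph to a packing pattern\<close>

text \<open>The pattern consists of the colour classes, inside the neighbourhood \<open>N\<close> of
  a vertex \<open>v\<close> of minimum degree, of a clique-free colouring of the graph without
  \<open>v\<close>. A colouring of \<open>N\<close> extends this colouring to the edges at
  \<open>v\<close>, and the resulting monochromatic clique must use \<open>v\<close>.\<close>

lemma packing_of_ramsey_minimal:
  assumes min: "ramsey_minimal r (complete_graph (k + 1)) V E" and k: "k \<ge> 2"
    and r: "r \<ge> 1"
  obtains N Gs where "finite N" "card N = min_degree V E" "colour_pattern N r Gs"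
    "pattern_free N r Gs (complete_graph (k + 1))"
    "\<forall>d. (\<forall>v\<in>N. d v < r) \<longrightarrow> strongly_mono_clique N r Gs d k"
proof -
  let ?K = "complete_graph (k + 1)"
  have gr: "graph V E" and arr: "arrows V E ?K r"
    and sub: "\<And>V' E'. graph V' E' \<Longrightarrow> V' \<subseteq> V \<Longrightarrow> E' \<subseteq> E \<Longrightarrow> (V', E') \<noteq> (V, E) \<Longrightarrow> \<not> arrows V' E' ?K r"
    using min unfolding ramsey_minimal_def by blast+
  have finV: "finite V" using gr by (simp add: graph_def)
  have ed: "u \<in> V \<and> v \<in> V \<and> u \<noteq> v" if "{u, v} \<in> E" for u v
  proof -
    obtain a b where "a \<in> V" "b \<in> V" "a \<noteq> b" "{u, v} = {a, b}"
      using gr \<open>{u, v} \<in> E\<close> unfolding graph_def by blast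
    then show ?thesis by (auto simp: doubleton_eq_iff)
  qed
  \<comment> \<open>Non-emptiness ensures that the minimum degree is attained.\<close>
  have "V \<noteq> {}"
  proof
    assume "V = {}"
    obtain i where "contains_copy V {e \<in> E. (0::nat) = i} ?K"
      using arr[unfolded arrows_def, rule_format, of "\<lambda>_. 0"] r by auto
    then show False unfolding contains_copy_complete \<open>V = {}\<close> by auto
  qed
  then have "min_degree V E \<in> degree E ` V"
    unfolding min_degree_def using finV by (intro Min_in) auto
  then obtain v where v: "v \<in> V" "min_degree V E = degree E v" by blast
  define V' where "V' = V - {v}"
  define E' where "E' = {e \<in> E. v \<notin> e}"
  have "graph V' E'"
    unfolding graph_def
  proof (intro conjI ballI)
    fix e assume e: "e \<in> E'"
    then obtain a b where "a \<in> V" "b \<in> V" "a \<noteq> b" "e = {a, b}"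
      using gr unfolding graph_def E'_def by blast
    then show "\<exists>u v. u \<in> V' \<and> v \<in> V' \<and> u \<noteq> v \<and> e = {u, v}"
      using e unfolding V'_def E'_def by blast
  qed (simp add: V'_def finV)
  moreover have "V' \<subseteq> V" "E' \<subseteq> E" "(V', E') \<noteq> (V, E)" using v(1) by (auto simp: V'_def E'_def)
  ultimately have "\<not> arrows V' E' ?K r" using sub by blast
  then obtain c where c: "\<forall>e\<in>E'. c e < r"
    and cfree: "\<And>i. i < r \<Longrightarrow> \<not> contains_copy V' {e \<in> E'. c e = i} ?K"
    unfolding arrows_def by blast
  define N where "N = {u. {u, v} \<in> E}"
  have NV: "N \<subseteq> V'" using ed by (auto simp: N_def V'_def)
  have finN: "finite N" using NV finV finite_subset by (auto simp: V'_def)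
  have vN: "v \<notin> N" using NV by (auto simp: V'_def)
  have "{e \<in> E. v \<in> e} = (\<lambda>u. {u, v}) ` N"
  proof (intro equalityI subsetI)
    fix e assume e: "e \<in> {e \<in> E. v \<in> e}"
    then obtain a b where "e = {a, b}" using gr by (auto simp: graph_def)
    then have "e = {a, v} \<or> e = {b, v}" using e by auto
    then show "e \<in> (\<lambda>u. {u, v}) ` N" using e by (auto simp: N_def)
  qed (auto simp: N_def)
  moreover have "inj_on (\<lambda>u. {u, v}) N" by (rule inj_onI) (auto simp: doubleton_eq_iff)
  ultimately have cardN: "card N = min_degree V E" using v(2) by (simp add: degree_def card_image)
  define Gs where "Gs i = {e \<in> E'. c e = i \<and> e \<subseteq> N}" for i
  have "graph N (Gs i)" for i
    unfolding graph_def
  proof (intro conjI ballI finN)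
    fix e assume e: "e \<in> Gs i"
    then obtain a b where "a \<noteq> b" "e = {a, b}"
      using gr unfolding graph_def Gs_def E'_def by blast
    then show "\<exists>u v. u \<in> N \<and> v \<in> N \<and> u \<noteq> v \<and> e = {u, v}"
      using e unfolding Gs_def by blast
  qed
  then have pat: "colour_pattern N r Gs" by (auto simp: colour_pattern_def Gs_def)
  have free: "pattern_free N r Gs ?K"
    unfolding pattern_free_def
  proof (intro allI impI notI)
    fix i assume "i < r" "contains_copy N (Gs i) ?K"
    moreover have "Gs i \<subseteq> {e \<in> E'. c e = i}" by (auto simp: Gs_def)
    ultimately show False using cfree contains_copy_mono[OF _ NV] by blast
  qed
  have "strongly_mono_clique N r Gs d k" if d: "\<forall>u\<in>N. d u < r" for d
  proof -
    \<comment> \<open>An edge at \<open>v\<close> gets the colour under \<open>d\<close> of its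
      other end; all other edges keep their colour under \<open>c\<close>.\<close>
    define c' where "c' e = (if v \<in> e then d (THE u. e = {u, v}) else c e)" for e
    have c'v: "c' {u, v} = d u" if "u \<in> N" for u
    proof -
      have "(THE x. {u, v} = {x, v}) = u" by (rule the_equality) (auto simp: doubleton_eq_iff)
      then show ?thesis by (simp add: c'_def)
    qed
    have "c' e < r" if e: "e \<in> E" for e
    proof (cases "v \<in> e")
      case True
      then have "e \<in> (\<lambda>u. {u, v}) ` N" using \<open>{e \<in> E. v \<in> e} = (\<lambda>u. {u, v}) ` N\<close> e by blast
      then show ?thesis using c'v d by auto
    next
      case False
      then show ?thesis using c e by (auto simp: c'_def E'_def)
    qed
    then obtain i where i: "i < r" "contains_copy V {e \<in> E. c' e = i} ?K"
      using arr unfolding arrows_def by blast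
    then obtain S where S: "S \<subseteq> V" "finite S" "card S = k + 1"
      and cl: "\<And>x y. x \<in> S \<Longrightarrow> y \<in> S \<Longrightarrow> x \<noteq> y \<Longrightarrow> {x, y} \<in> E \<and> c' {x, y} = i"
      unfolding contains_copy_complete by auto
    have vS: "v \<in> S"
    proof (rule ccontr)
      assume "v \<notin> S"
      then have "S \<subseteq> V'" using S(1) by (auto simp: V'_def)
      moreover have "{x, y} \<in> {e \<in> E'. c e = i}" if "x \<in> S" "y \<in> S" "x \<noteq> y" for x y
        using cl[OF that] \<open>v \<notin> S\<close> that by (auto simp: E'_def c'_def split: if_splits)
      ultimately have "contains_copy V' {e \<in> E'. c e = i} ?K"
        unfolding contains_copy_complete using S(2,3) by blast
      then show False using cfree i(1) by blast
    qed
    let ?S = "S - {v}"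
    have SN: "?S \<subseteq> N" using cl vS by (auto simp: N_def)
    have "card ?S = k" using S vS by simp
    moreover have "d u = i" if "u \<in> ?S" for u
      using cl[of u v] c'v[of u] vS that SN by auto
    moreover have "{x, y} \<in> Gs i" if "x \<in> ?S" "y \<in> ?S" "x \<noteq> y" for x y
    proof -
      have "{x, y} \<in> E" "c' {x, y} = i" using cl that by auto
      moreover have "x \<in> N" "y \<in> N" "v \<noteq> x" "v \<noteq> y" using that SN by blast+
      ultimately show ?thesis by (simp add: Gs_def E'_def c'_def)
    qed
    ultimately show ?thesis
      unfolding strongly_mono_clique_def using i(1) SN by blast
  qed
  then show ?thesis by (intro that[OF finN cardN pat free]) simp
qed

section \<open>Comparison of the two infima\<close>

text \<open>Every minimum degree of a Ramsey-minimal graph is the size of a packing pattern, and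
  every such size is at least some minimum degree; so the infima agree although the two sets may
  differ.\<close>

theorem theorem4:
  fixes r k :: nat
  assumes "r \<ge> 2" and "k \<ge> 2"
  shows "s_ramsey r (complete_graph (k + 1)) = clique_packing r k"
proof -
  let ?D = "{min_degree V E | V E. ramsey_minimal r (complete_graph (k + 1)) V E}"
  let ?P = "{n. \<exists>V Gs. finite V \<and> card V = n \<and> colour_pattern V r Gs \<and>
      pattern_free V r Gs (complete_graph (k + 1)) \<and>
      (\<forall>c :: nat \<Rightarrow> nat. (\<forall>v\<in>V. c v < r) \<longrightarrow> strongly_mono_clique V r Gs c k)}"
  have DP: "?D \<subseteq> ?P"
  proof
    fix n assume "n \<in> ?D"
    then obtain V E where n: "n = min_degree V E"
      and min: "ramsey_minimal r (complete_graph (k + 1)) V E" by blast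
    have "r \<ge> 1" using assms(1) by simp
    from packing_of_ramsey_minimal[OF min assms(2) this]
    obtain N Gs where "finite N" "card N = n" "colour_pattern N r Gs"
      "pattern_free N r Gs (complete_graph (k + 1))"
      "\<forall>d. (\<forall>v\<in>N. d v < r) \<longrightarrow> strongly_mono_clique N r Gs d k"
      unfolding n .
    then show "n \<in> ?P" by blast
  qed
  have PD: "\<exists>m\<in>?D. m \<le> n" if n: "n \<in> ?P" for n
  proof -
    obtain V Gs where V: "finite V" "card V = n" "colour_pattern V r Gs"
      "pattern_free V r Gs (complete_graph (k + 1))"
      and strong: "\<forall>c. (\<forall>v\<in>V. c v < r) \<longrightarrow> strongly_mono_clique V r Gs c k"
      using n by blast
    obtain V' E' where min: "ramsey_minimal r (complete_graph (k + 1)) V' E'"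
      and le: "min_degree V' E' \<le> card V"
      using ramsey_minimal_of_packing[OF V(1,3,4) strong assms(2,1)] .
    show ?thesis
    proof (rule bexI)
      show "min_degree V' E' \<le> n" using le V(2) by simp
      show "min_degree V' E' \<in> ?D" using min by blast
    qed
  qed
  text \<open>If both sets are empty, both sides are the infimum of the empty set, so no existence
    argument is needed.\<close>
  show ?thesis
  proof (cases "?P = {}")
    case True
    then have "?D = ?P" using DP by blast
    then show ?thesis unfolding s_ramsey_def clique_packing_def by simp
  next
    case False
    then have "?D \<noteq> {}" using PD by blast
    have "Inf ?D = Inf ?P"
    proof (rule antisym)
      show "Inf ?D \<le> Inf ?P"
        using PD[OF Inf_nat_def1[OF False]] cInf_lower[of _ ?D] by (meson bdd_below_bot le_trans)
      show "Inf ?P \<le> Inf ?D"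
        by (rule cInf_superset_mono[OF \<open>?D \<noteq> {}\<close> _ DP]) simp
    qed
    then show ?thesis unfolding s_ramsey_def clique_packing_def .
  qed
qed

end
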